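(* Every loopless matroid is isomorphic to the local matroid of a tropical linear series at a nondegenerate divisor. That is, for every loopless matroid $M$ there exist a metric graph $\Gamma$, a divisor $D$ on $\Gamma$, and a tropical linear series $\Sigma\subseteq R(D)$ such that $D\in|\Sigma|$ is nondegenerate and $M_\Sigma\cong M$.
   Context: A matroid is loopless if every single-element subset of its ground set is independent (equivalently, the empty set is a flat). A metric graph is the metric space of a finite connected graph (loops and multiple edges allowed) with positive real edge lengths; the valence of a point is its number of tangent directions. A divisor $D$ is a finite formal $\mathbb Z$-combination of points; it is effective ($\ge0$) if all coefficients are nonnegative; $\mathrm{supp}(D)$ is the set of points with nonzero coefficient. $\mathrm{PL}(\Gamma)$ is the set of continuous piecewise-linear functions with integer slopes; $\mathrm{div}(\varphi)$ is the divisor whose multiplicity at $p$ is the sum of the incoming slopes (minus the sum of the outgoing slopes) of $\varphi$ at $p$; $R(D)=\{\varphi\in\mathrm{PL}(\Gamma):D+\mathrm{div}(\varphi)\ge0\}$. A tropical submodule of $R(D)$ is a subset closed under pointwise minimum and addition of real constants (a zero element $\infty$ is tacitly adjoined); it is finitely generated if it is the set of all finite tropical linear combinations $\min_i\{\varphi_i+a_i\}$ of a finite set of elements. $r_{\mathrm{BN}}(\Sigma)$ is the largest integer $r$ such that for every effective divisor $D'$ of degree $r$ there is $\varphi\in\Sigma$ with $D-D'+\mathrm{div}(\varphi)\ge0$. A finite set $\{\varphi_0,\dots,\varphi_s\}$ is tropically dependent if there are reals $a_i$ such that at every point of $\Gamma$ the minimum $\min_i\{\varphi_i+a_i\}$ is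 achieved at least twice, and independent otherwise; $r_{\mathrm{ind}}(\Sigma)$ is the size of the largest tropically independent subset. A tropical linear series of dimension $r$ is a finitely generated $\Sigma\subseteq R(D)$ with $r_{\mathrm{BN}}(\Sigma)=r$ and $r_{\mathrm{ind}}(\Sigma)=r+1$. $|\Sigma|=\{D+\mathrm{div}(\varphi):\varphi\in\Sigma\}$, topologized as a subset of $\mathrm{Sym}^{d}(\Gamma)=\Gamma^d/S_d$, $d=\deg D$. The valence 1 degree of a divisor is the sum of its multiplicities at the valence 1 points of $\Gamma$. $D\in|\Sigma|$ is nondegenerate if the function $\#\mathrm{supp}$ has a local maximum on $|\Sigma|$ at $D$ and the valence 1 degree has a local minimum on $|\Sigma|$ at $D$. Local matroid: let $E$ be the set of connected components of $\Gamma\smallsetminus\mathrm{supp}(D)$; for $\varphi\in\Sigma$ let $\varphi_{\min}=\{p:\varphi(p)=\min_\Gamma\varphi\}$ and $F_\varphi=\{S\in E:S\not\subseteq\varphi_{\min}\}$. When $D\in|\Sigma|$ is nondegenerate, the collection $\{F_\varphi:\varphi\in\Sigma\}\cup\{E\}$ is the lattice of flats of a matroid of rank $r+1$ on $E$, called the local matroid $M_\Sigma$.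
   Formalization: The matroid is assumed to have a nonempty ground set; for the empty matroid (vacuously loopless) the claim fails, since Γ would be a single point with r_BN ≥ 1 and r_ind = 1. *)

theory Defs
  imports "HOL-Analysis.Analysis"
begin

section \<open>Matroids\<close>

record 'a matroid_data =
  ground :: "'a set"
  indep :: "'a set \<Rightarrow> bool"

definition matroid :: "'a matroid_data \<Rightarrow> bool" where
  "matroid M \<longleftrightarrow>
     finite (ground M) \<and>
     (\<forall>X. indep M X \<longrightarrow> X \<subseteq> ground M) \<and>
     indep M {} \<and>
     (\<forall>X Y. indep M Y \<longrightarrow> X \<subseteq> Y \<longrightarrow> indep M X) \<and>
     (\<forall>X Y. indep M X \<longrightarrow> indep M Y \<longrightarrow> card X < card Y \<longrightarrow>
        (\<exists>y\<in>Y - X. indep M (insert y X)))"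

definition loopless :: "'a matroid_data \<Rightarrow> bool" where
  "loopless M \<longleftrightarrow> (\<forall>x\<in>ground M. indep M {x})"

definition mrank :: "'a matroid_data \<Rightarrow> 'a set \<Rightarrow> nat" where
  "mrank M X = Max {card Y | Y. Y \<subseteq> X \<and> indep M Y}"

definition flat :: "'a matroid_data \<Rightarrow> 'a set \<Rightarrow> bool" where
  "flat M F \<longleftrightarrow> F \<subseteq> ground M \<and> (\<forall>x\<in>ground M - F. mrank M F < mrank M (insert x F))"

definition matroid_iso :: "'a matroid_data \<Rightarrow> 'b matroid_data \<Rightarrow> bool" where
  "matroid_iso M N \<longleftrightarrow>
     (\<exists>f. bij_betw f (ground M) (ground N) \<and>
          (\<forall>X. X \<subseteq> ground M \<longrightarrow> (indep M X \<longleftrightarrow> indep N (f ` X))))"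


section \<open>Metric graphs\<close>

text \<open>The orientation \<open>tail e\<close>, \<open>head e\<close> of an edge only serves to coordinatize it by the
  interval from \<open>0\<close> to \<open>len e\<close>; loops and multiple edges are allowed.\<close>

record ('v, 'e) metric_graph_data =
  verts :: "'v set"
  edges :: "'e set"
  tail :: "'e \<Rightarrow> 'v"
  head :: "'e \<Rightarrow> 'v"
  len :: "'e \<Rightarrow> real"

definition metric_graph :: "('v, 'e) metric_graph_data \<Rightarrow> bool" where
  "metric_graph \<Gamma> \<longleftrightarrow>
     finite (verts \<Gamma>) \<and> verts \<Gamma> \<noteq> {} \<and> finite (edges \<Gamma>) \<and>
     (\<forall>e\<in>edges \<Gamma>. tail \<Gamma> e \<in> verts \<Gamma> \<and> head \<Gamma> e \<in> verts \<Gamma> \<and> len \<Gamma> e > 0) \<and>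
     (\<forall>u\<in>verts \<Gamma>. \<forall>v\<in>verts \<Gamma>.
        (u, v) \<in> (\<Union>e\<in>edges \<Gamma>. {(tail \<Gamma> e, head \<Gamma> e), (head \<Gamma> e, tail \<Gamma> e)})\<^sup>*)"

datatype ('v, 'e) point = Vertex 'v | Interior 'e real

definition points :: "('v, 'e) metric_graph_data \<Rightarrow> ('v, 'e) point set" where
  "points \<Gamma> = Vertex ` verts \<Gamma> \<union> {Interior e t | e t. e \<in> edges \<Gamma> \<and> 0 < t \<and> t < len \<Gamma> e}"

text \<open>The closed edge \<open>e\<close>, parametrized by arc length on \<open>{0..len e}\<close>.\<close>

definition edge_pt :: "('v, 'e) metric_graph_data \<Rightarrow> 'e \<Rightarrow> real \<Rightarrow> ('v, 'e) point" where
  "edge_pt \<Gamma> e t =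
     (if t \<le> 0 then Vertex (tail \<Gamma> e)
      else if t \<ge> len \<Gamma> e then Vertex (head \<Gamma> e)
      else Interior e t)"

text \<open>\<open>walk \<Gamma> x y l\<close>: one can go from \<open>x\<close> to \<open>y\<close> by finitely many moves, each inside a single
  closed edge, of total length \<open>l\<close>.\<close>

inductive walk :: "('v, 'e) metric_graph_data \<Rightarrow> ('v, 'e) point \<Rightarrow> ('v, 'e) point \<Rightarrow> real \<Rightarrow> bool"
  for \<Gamma> where
  stay: "x \<in> points \<Gamma> \<Longrightarrow> walk \<Gamma> x x 0"
| move: "walk \<Gamma> x (edge_pt \<Gamma> e s) l \<Longrightarrow> e \<in> edges \<Gamma> \<Longrightarrow>
         s \<in> {0..len \<Gamma> e} \<Longrightarrow> t \<in> {0..len \<Gamma> e} \<Longrightarrow> walk \<Gamma> x (edge_pt \<Gamma> e t) (l + \<bar>t - s\<bar>)"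

definition gdist :: "('v, 'e) metric_graph_data \<Rightarrow> ('v, 'e) point \<Rightarrow> ('v, 'e) point \<Rightarrow> real" where
  "gdist \<Gamma> x y = (if x \<in> points \<Gamma> \<and> y \<in> points \<Gamma> then Inf {l. walk \<Gamma> x y l} else 0)"

definition gtop :: "('v, 'e) metric_graph_data \<Rightarrow> ('v, 'e) point topology" where
  "gtop \<Gamma> = Metric_space.mtopology (points \<Gamma>) (gdist \<Gamma>)"

text \<open>A tangent direction at \<open>p\<close> is a triple \<open>(e, t, \<sigma>)\<close>: \<open>p\<close> is the point of the edge \<open>e\<close> with
  coordinate \<open>t\<close>, and one leaves it along \<open>e\<close> with the coordinate increasing (\<open>\<sigma> = 1\<close>) or
  decreasing (\<open>\<sigma> = -1\<close>). A loop contributes two directions at its vertex.\<close>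

definition tangents :: "('v, 'e) metric_graph_data \<Rightarrow> ('v, 'e) point \<Rightarrow> ('e \<times> real \<times> real) set" where
  "tangents \<Gamma> p = {(e, t, \<sigma>). e \<in> edges \<Gamma> \<and> t \<in> {0..len \<Gamma> e} \<and> edge_pt \<Gamma> e t = p \<and>
                     (\<sigma> = 1 \<and> t < len \<Gamma> e \<or> \<sigma> = -1 \<and> 0 < t)}"

definition valence :: "('v, 'e) metric_graph_data \<Rightarrow> ('v, 'e) point \<Rightarrow> nat" where
  "valence \<Gamma> p = card (tangents \<Gamma> p)"


section \<open>Divisors and piecewise linear functions\<close>

type_synonym ('v, 'e) divisor = "('v, 'e) point \<Rightarrow> int"

definition supp :: "('v, 'e) divisor \<Rightarrow> ('v, 'e) point set" where
  "supp D = {p. D p \<noteq> 0}"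

definition is_divisor :: "('v, 'e) metric_graph_data \<Rightarrow> ('v, 'e) divisor \<Rightarrow> bool" where
  "is_divisor \<Gamma> D \<longleftrightarrow> finite (supp D) \<and> supp D \<subseteq> points \<Gamma>"

definition effective :: "('v, 'e) divisor \<Rightarrow> bool" where
  "effective D \<longleftrightarrow> (\<forall>p. D p \<ge> 0)"

definition deg :: "('v, 'e) divisor \<Rightarrow> int" where
  "deg D = sum D (supp D)"

definition valence_one_degree :: "('v, 'e) metric_graph_data \<Rightarrow> ('v, 'e) divisor \<Rightarrow> int" where
  "valence_one_degree \<Gamma> D = sum D {p \<in> points \<Gamma>. valence \<Gamma> p = 1}"

text \<open>Functions on \<open>\<Gamma>\<close> are extensional, so that equality is equality on \<open>points \<Gamma>\<close>. Continuity is
  part of the definition of \<open>PL\<close>: the linear pieces are closed intervals covering each closed edge,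
  and \<open>\<phi>\<close> has a single value at each vertex.\<close>

definition PL :: "('v, 'e) metric_graph_data \<Rightarrow> (('v, 'e) point \<Rightarrow> real) set" where
  "PL \<Gamma> = {\<phi> \<in> extensional (points \<Gamma>). \<forall>e\<in>edges \<Gamma>.
     \<exists>(n::nat) (b :: nat \<Rightarrow> real). b 0 = 0 \<and> b n = len \<Gamma> e \<and>
       (\<forall>i<n. b i < b (Suc i) \<and>
          (\<exists>s::int. \<forall>t\<in>{b i..b (Suc i)}.
             \<phi> (edge_pt \<Gamma> e t) = \<phi> (edge_pt \<Gamma> e (b i)) + of_int s * (t - b i)))}"

fun has_outgoing_slope :: "('v, 'e) metric_graph_data \<Rightarrow> (('v, 'e) point \<Rightarrow> real) \<Rightarrow>
    'e \<times> real \<times> real \<Rightarrow> int \<Rightarrow> bool" where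
  "has_outgoing_slope \<Gamma> \<phi> (e, t, \<sigma>) s \<longleftrightarrow>
     (\<exists>\<epsilon>>0. \<forall>h\<in>{0..\<epsilon>}. \<phi> (edge_pt \<Gamma> e (t + \<sigma> * h)) = \<phi> (edge_pt \<Gamma> e t) + of_int s * h)"

definition outgoing_slope :: "('v, 'e) metric_graph_data \<Rightarrow> (('v, 'e) point \<Rightarrow> real) \<Rightarrow>
    'e \<times> real \<times> real \<Rightarrow> int" where
  "outgoing_slope \<Gamma> \<phi> \<zeta> = (THE s. has_outgoing_slope \<Gamma> \<phi> \<zeta> s)"

text \<open>The incoming slope along a tangent direction is the negative of the outgoing slope.\<close>

definition div_of :: "('v, 'e) metric_graph_data \<Rightarrow> (('v, 'e) point \<Rightarrow> real) \<Rightarrow> ('v, 'e) divisor" where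
  "div_of \<Gamma> \<phi> p = (if p \<in> points \<Gamma> then \<Sum>\<zeta>\<in>tangents \<Gamma> p. - outgoing_slope \<Gamma> \<phi> \<zeta> else 0)"

definition RD :: "('v, 'e) metric_graph_data \<Rightarrow> ('v, 'e) divisor \<Rightarrow> (('v, 'e) point \<Rightarrow> real) set" where
  "RD \<Gamma> D = {\<phi> \<in> PL \<Gamma>. effective (\<lambda>p. D p + div_of \<Gamma> \<phi> p)}"


section \<open>Tropical linear series\<close>

text \<open>The zero element \<open>\<infinity>\<close> is not represented: submodules are given by their finite elements, and
  tropical linear combinations are over nonempty sets of elements with finite coefficients.\<close>

definition tropical_submodule :: "('v, 'e) metric_graph_data \<Rightarrow> ('v, 'e) divisor \<Rightarrow>
    (('v, 'e) point \<Rightarrow> real) set \<Rightarrow> bool" where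
  "tropical_submodule \<Gamma> D \<Sigma> \<longleftrightarrow> \<Sigma> \<subseteq> RD \<Gamma> D \<and>
     (\<forall>\<phi>\<in>\<Sigma>. \<forall>\<psi>\<in>\<Sigma>. (\<lambda>p\<in>points \<Gamma>. min (\<phi> p) (\<psi> p)) \<in> \<Sigma>) \<and>
     (\<forall>\<phi>\<in>\<Sigma>. \<forall>a::real. (\<lambda>p\<in>points \<Gamma>. \<phi> p + a) \<in> \<Sigma>)"

definition tropical_span :: "('v, 'e) metric_graph_data \<Rightarrow> (('v, 'e) point \<Rightarrow> real) set \<Rightarrow>
    (('v, 'e) point \<Rightarrow> real) set" where
  "tropical_span \<Gamma> G =
     {(\<lambda>p\<in>points \<Gamma>. Min ((\<lambda>\<psi>. \<psi> p + a \<psi>) ` H)) | H a. finite H \<and> H \<noteq> {} \<and> H \<subseteq> G}"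

definition finitely_generated :: "('v, 'e) metric_graph_data \<Rightarrow>
    (('v, 'e) point \<Rightarrow> real) set \<Rightarrow> bool" where
  "finitely_generated \<Gamma> \<Sigma> \<longleftrightarrow> (\<exists>G. finite G \<and> G \<subseteq> \<Sigma> \<and> \<Sigma> = tropical_span \<Gamma> G)"

definition is_largest :: "(int \<Rightarrow> bool) \<Rightarrow> int \<Rightarrow> bool" where
  "is_largest P r \<longleftrightarrow> P r \<and> (\<forall>s. P s \<longrightarrow> s \<le> r)"

definition BN_rank :: "('v, 'e) metric_graph_data \<Rightarrow> ('v, 'e) divisor \<Rightarrow>
    (('v, 'e) point \<Rightarrow> real) set \<Rightarrow> int \<Rightarrow> bool" where
  "BN_rank \<Gamma> D \<Sigma> = is_largest (\<lambda>r. \<forall>D'. is_divisor \<Gamma> D' \<and> effective D' \<and> deg D' = r \<longrightarrow>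
     (\<exists>\<phi>\<in>\<Sigma>. effective (\<lambda>p. D p - D' p + div_of \<Gamma> \<phi> p)))"

definition tropically_dependent :: "('v, 'e) metric_graph_data \<Rightarrow>
    (('v, 'e) point \<Rightarrow> real) set \<Rightarrow> bool" where
  "tropically_dependent \<Gamma> S \<longleftrightarrow>
     (\<exists>a. \<forall>p\<in>points \<Gamma>. \<exists>\<phi>\<in>S. \<exists>\<psi>\<in>S. \<phi> \<noteq> \<psi> \<and> \<phi> p + a \<phi> = \<psi> p + a \<psi> \<and>
        (\<forall>\<theta>\<in>S. \<phi> p + a \<phi> \<le> \<theta> p + a \<theta>))"

definition ind_rank :: "('v, 'e) metric_graph_data \<Rightarrow>
    (('v, 'e) point \<Rightarrow> real) set \<Rightarrow> int \<Rightarrow> bool" where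
  "ind_rank \<Gamma> \<Sigma> = is_largest (\<lambda>k. \<exists>S. S \<subseteq> \<Sigma> \<and> finite S \<and> \<not> tropically_dependent \<Gamma> S \<and>
     int (card S) = k)"

definition tropical_linear_series :: "('v, 'e) metric_graph_data \<Rightarrow> ('v, 'e) divisor \<Rightarrow>
    (('v, 'e) point \<Rightarrow> real) set \<Rightarrow> int \<Rightarrow> bool" where
  "tropical_linear_series \<Gamma> D \<Sigma> r \<longleftrightarrow>
     tropical_submodule \<Gamma> D \<Sigma> \<and> finitely_generated \<Gamma> \<Sigma> \<and>
     BN_rank \<Gamma> D \<Sigma> r \<and> ind_rank \<Gamma> \<Sigma> (r + 1)"


section \<open>Nondegenerate divisors\<close>

definition linear_system :: "('v, 'e) metric_graph_data \<Rightarrow> ('v, 'e) divisor \<Rightarrow>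
    (('v, 'e) point \<Rightarrow> real) set \<Rightarrow> ('v, 'e) divisor set" where
  "linear_system \<Gamma> D \<Sigma> = (\<lambda>\<phi> p. D p + div_of \<Gamma> \<phi> p) ` \<Sigma>"

definition quotient_topology :: "'a topology \<Rightarrow> ('a \<Rightarrow> 'b) \<Rightarrow> 'b topology" where
  "quotient_topology X f =
     topology (\<lambda>U. U \<subseteq> f ` topspace X \<and> openin X {x \<in> topspace X. f x \<in> U})"

text \<open>The fibres of \<open>tuple_divisor d\<close> are the \<open>S_d\<close>-orbits of \<open>\<Gamma>^d\<close> and its image consists of the
  effective divisors of degree \<open>d\<close>, so these form the underlying set of \<open>\<Gamma>^d / S_d\<close>.\<close>

definition tuple_divisor :: "nat \<Rightarrow> (nat \<Rightarrow> ('v, 'e) point) \<Rightarrow> ('v, 'e) divisor" where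
  "tuple_divisor d x p = int (card {i. i < d \<and> x i = p})"

definition Sym :: "('v, 'e) metric_graph_data \<Rightarrow> nat \<Rightarrow> ('v, 'e) divisor topology" where
  "Sym \<Gamma> d = quotient_topology (product_topology (\<lambda>_. gtop \<Gamma>) {..<d}) (tuple_divisor d)"

definition linear_system_top :: "('v, 'e) metric_graph_data \<Rightarrow> ('v, 'e) divisor \<Rightarrow>
    (('v, 'e) point \<Rightarrow> real) set \<Rightarrow> ('v, 'e) divisor topology" where
  "linear_system_top \<Gamma> D \<Sigma> = subtopology (Sym \<Gamma> (nat (deg D))) (linear_system \<Gamma> D \<Sigma>)"

definition local_max_at :: "'a topology \<Rightarrow> ('a \<Rightarrow> 'b::linorder) \<Rightarrow> 'a \<Rightarrow> bool" where
  "local_max_at X f x \<longleftrightarrow> (\<exists>U. openin X U \<and> x \<in> U \<and> (\<forall>y\<in>U. f y \<le> f x))"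

definition local_min_at :: "'a topology \<Rightarrow> ('a \<Rightarrow> 'b::linorder) \<Rightarrow> 'a \<Rightarrow> bool" where
  "local_min_at X f x \<longleftrightarrow> (\<exists>U. openin X U \<and> x \<in> U \<and> (\<forall>y\<in>U. f x \<le> f y))"

definition nondegenerate :: "('v, 'e) metric_graph_data \<Rightarrow> ('v, 'e) divisor \<Rightarrow>
    (('v, 'e) point \<Rightarrow> real) set \<Rightarrow> bool" where
  "nondegenerate \<Gamma> D \<Sigma> \<longleftrightarrow> D \<in> linear_system \<Gamma> D \<Sigma> \<and>
     local_max_at (linear_system_top \<Gamma> D \<Sigma>) (\<lambda>D'. card (supp D')) D \<and>
     local_min_at (linear_system_top \<Gamma> D \<Sigma>) (valence_one_degree \<Gamma>) D"


section \<open>The local matroid\<close>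

definition complement_components :: "('v, 'e) metric_graph_data \<Rightarrow> ('v, 'e) divisor \<Rightarrow>
    ('v, 'e) point set set" where
  "complement_components \<Gamma> D =
     connected_components_of (subtopology (gtop \<Gamma>) (points \<Gamma> - supp D))"

definition min_set :: "('v, 'e) metric_graph_data \<Rightarrow> (('v, 'e) point \<Rightarrow> real) \<Rightarrow>
    ('v, 'e) point set" where
  "min_set \<Gamma> \<phi> = {p \<in> points \<Gamma>. \<forall>q\<in>points \<Gamma>. \<phi> p \<le> \<phi> q}"

definition F_of :: "('v, 'e) metric_graph_data \<Rightarrow> ('v, 'e) divisor \<Rightarrow>
    (('v, 'e) point \<Rightarrow> real) \<Rightarrow> ('v, 'e) point set set" where
  "F_of \<Gamma> D \<phi> = {S \<in> complement_components \<Gamma> D. \<not> S \<subseteq> min_set \<Gamma> \<phi>}"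

text \<open>A matroid is determined by its ground set and its flats, so at most one matroid satisfies
  this predicate.\<close>

definition is_local_matroid :: "('v, 'e) metric_graph_data \<Rightarrow> ('v, 'e) divisor \<Rightarrow>
    (('v, 'e) point \<Rightarrow> real) set \<Rightarrow> ('v, 'e) point set matroid_data \<Rightarrow> bool" where
  "is_local_matroid \<Gamma> D \<Sigma> N \<longleftrightarrow> matroid N \<and> ground N = complement_components \<Gamma> D \<and>
     {F. flat N F} = F_of \<Gamma> D ` \<Sigma> \<union> {complement_components \<Gamma> D}"


section \<open>Well-definedness of the constructions above\<close>

lemma openin_quotient_topology:
  "openin (quotient_topology X f) U \<longleftrightarrow>
     U \<subseteq> f ` topspace X \<and> openin X {x \<in> topspace X. f x \<in> U}"
proof -
  have "istopology (\<lambda>U. U \<subseteq> f ` topspace X \<and> openin X {x \<in> topspace X. f x \<in> U})"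
    unfolding istopology_def
  proof (intro conjI allI impI)
    fix S T assume "S \<subseteq> f ` topspace X \<and> openin X {x \<in> topspace X. f x \<in> S}"
      "T \<subseteq> f ` topspace X \<and> openin X {x \<in> topspace X. f x \<in> T}"
    moreover have "{x \<in> topspace X. f x \<in> S \<inter> T}
        = {x \<in> topspace X. f x \<in> S} \<inter> {x \<in> topspace X. f x \<in> T}" by auto
    ultimately show "openin X {x \<in> topspace X. f x \<in> S \<inter> T}" by auto
    show "S \<inter> T \<subseteq> f ` topspace X" using \<open>S \<subseteq> _ \<and> _\<close> by auto
  next
    fix \<K> assume K: "\<forall>K\<in>\<K>. K \<subseteq> f ` topspace X \<and> openin X {x \<in> topspace X. f x \<in> K}"
    have "{x \<in> topspace X. f x \<in> \<Union>\<K>} = (\<Union>K\<in>\<K>. {x \<in> topspace X. f x \<in> K})" by auto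
    then show "openin X {x \<in> topspace X. f x \<in> \<Union>\<K>}" using K by auto
    show "\<Union>\<K> \<subseteq> f ` topspace X" using K by auto
  qed
  then show ?thesis by (simp add: quotient_topology_def topology_inverse')
qed

lemma edge_pt_in: "metric_graph \<Gamma> \<Longrightarrow> e \<in> edges \<Gamma> \<Longrightarrow> edge_pt \<Gamma> e t \<in> points \<Gamma>"
  by (auto simp: metric_graph_def edge_pt_def points_def)

lemma walk_nonneg: "walk \<Gamma> x y l \<Longrightarrow> 0 \<le> l"
  by (induction rule: walk.induct) auto

lemma walk_points: "walk \<Gamma> x y l \<Longrightarrow> metric_graph \<Gamma> \<Longrightarrow> x \<in> points \<Gamma> \<and> y \<in> points \<Gamma>"
  by (induction rule: walk.induct) (auto simp: edge_pt_in)

lemma walk_trans: "walk \<Gamma> y z k \<Longrightarrow> walk \<Gamma> x y l \<Longrightarrow> walk \<Gamma> x z (l + k)"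
proof (induction rule: walk.induct)
  case (stay x) then show ?case by simp
next
  case (move y e s l' t)
  then have "walk \<Gamma> x (edge_pt \<Gamma> e t) (l + l' + \<bar>t - s\<bar>)" by (auto intro: walk.move)
  then show ?case by (simp add: add.assoc)
qed

lemma walk_sym: assumes g: "metric_graph \<Gamma>" shows "walk \<Gamma> x y l \<Longrightarrow> walk \<Gamma> y x l"
proof (induction rule: walk.induct)
  case (stay x) then show ?case by (auto intro: walk.stay)
next
  case (move x e s l t)
  have "walk \<Gamma> (edge_pt \<Gamma> e t) (edge_pt \<Gamma> e s) (0 + \<bar>s - t\<bar>)"
    using move g by (intro walk.move walk.stay edge_pt_in) auto
  from walk_trans[OF move.IH this] show ?case by (simp add: abs_minus_commute add.commute)
qed

lemma walk_lip:
  assumes "\<And>e s t. e \<in> edges \<Gamma> \<Longrightarrow> s \<in> {0..len \<Gamma> e} \<Longrightarrow> t \<in> {0..len \<Gamma> e} \<Longrightarrow>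
     \<bar>f (edge_pt \<Gamma> e t) - f (edge_pt \<Gamma> e s)\<bar> \<le> K * \<bar>t - s\<bar>"
  shows "walk \<Gamma> x y l \<Longrightarrow> \<bar>f x - f y\<bar> \<le> (K::real) * l"
proof (induction rule: walk.induct)
  case (stay x) then show ?case by simp
next
  case (move x e s l t)
  then have "\<bar>f (edge_pt \<Gamma> e t) - f (edge_pt \<Gamma> e s)\<bar> \<le> K * \<bar>t - s\<bar>" by (intro assms) auto
  then show ?case using move.IH by (simp add: algebra_simps)
qed

lemma walk_ex:
  assumes g: "metric_graph \<Gamma>" and x: "x \<in> points \<Gamma>" and y: "y \<in> points \<Gamma>"
  shows "\<exists>l. walk \<Gamma> x y l"
proof -
  have 1: "\<exists>v\<in>verts \<Gamma>. \<exists>l. walk \<Gamma> (Vertex v) x l" if "x \<in> points \<Gamma>" for x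
  proof (cases x)
    case (Vertex v)
    then show ?thesis using that walk.stay[OF that] by (auto simp: points_def)
  next
    case (Interior e t)
    then have e: "e \<in> edges \<Gamma>" "0 < t" "t < len \<Gamma> e" using that by (auto simp: points_def)
    have "edge_pt \<Gamma> e 0 \<in> points \<Gamma>" by (rule edge_pt_in[OF g e(1)])
    from walk.move[OF walk.stay[OF this] e(1), of t]
    have "walk \<Gamma> (Vertex (tail \<Gamma> e)) x \<bar>t\<bar>" using e Interior by (auto simp: edge_pt_def)
    then show ?thesis using g e by (auto simp: metric_graph_def)
  qed
  have 2: "\<exists>l. walk \<Gamma> (Vertex u) (Vertex v) l" if u: "u \<in> verts \<Gamma>" and v: "v \<in> verts \<Gamma>" for u v
  proof -
    have "(u, v) \<in> (\<Union>e\<in>edges \<Gamma>. {(tail \<Gamma> e, head \<Gamma> e), (head \<Gamma> e, tail \<Gamma> e)})\<^sup>*"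
      using g u v by (auto simp: metric_graph_def)
    then show ?thesis
    proof (induction rule: rtrancl_induct)
      case base show ?case using u walk.stay[of "Vertex u" \<Gamma>] by (auto simp: points_def)
    next
      case (step w z)
      then obtain l e where l: "walk \<Gamma> (Vertex u) (Vertex w) l" and e: "e \<in> edges \<Gamma>"
        "(w, z) = (tail \<Gamma> e, head \<Gamma> e) \<or> (w, z) = (head \<Gamma> e, tail \<Gamma> e)" by auto
      have L: "len \<Gamma> e > 0" using g e by (auto simp: metric_graph_def)
      have a: "edge_pt \<Gamma> e 0 = Vertex (tail \<Gamma> e)" "edge_pt \<Gamma> e (len \<Gamma> e) = Vertex (head \<Gamma> e)"
        using L by (auto simp: edge_pt_def)
      show ?case using e(2)
      proof
        assume "(w, z) = (tail \<Gamma> e, head \<Gamma> e)"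
        then show ?thesis
          using walk.move[of \<Gamma> "Vertex u" e 0 l "len \<Gamma> e"] l e L a by auto
      next
        assume "(w, z) = (head \<Gamma> e, tail \<Gamma> e)"
        then show ?thesis
          using walk.move[of \<Gamma> "Vertex u" e "len \<Gamma> e" l 0] l e L a by auto
      qed
    qed
  qed
  from 1[OF x] 1[OF y] 2 show ?thesis by (meson walk_sym[OF g] walk_trans)
qed

definition tent :: "'e \<Rightarrow> real \<Rightarrow> real \<Rightarrow> ('v,'e) point \<Rightarrow> real" where
  "tent e t d p = (case p of Vertex v \<Rightarrow> 0 | Interior e' s \<Rightarrow> if e' = e then max 0 (d - \<bar>s - t\<bar>) else 0)"

lemma sep1:
  fixes \<Gamma> :: "('v, 'e) metric_graph_data"
  assumes g: "metric_graph \<Gamma>" and x: "Interior e t \<in> points \<Gamma>" and y: "y \<noteq> Interior e t"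
  shows "\<exists>c>0. \<forall>l. walk \<Gamma> (Interior e t) y l \<longrightarrow> c \<le> l"
proof -
  have et: "0 < t" "t < len \<Gamma> e" using x by (auto simp: points_def)
  define d0 where "d0 = (case y of Vertex v \<Rightarrow> 1 | Interior e' s \<Rightarrow> if e' = e then \<bar>s - t\<bar> else 1)"
  have d0: "d0 > 0" using y by (auto simp: d0_def split: point.splits)
  define d where "d = min d0 (min t (len \<Gamma> e - t))"
  have d: "d > 0" "d \<le> d0" "d \<le> t" "d \<le> len \<Gamma> e - t" using d0 et by (auto simp: d_def)
  have ty: "tent e t d y = 0" using d(2) by (auto simp: tent_def d0_def split: point.splits)
  have tx: "tent e t d (Interior e t :: ('v, 'e) point) = d" using d(1) by (auto simp: tent_def)
  have form: "tent e t d (edge_pt \<Gamma> e' s) = (if e' = e then max 0 (d - \<bar>s - t\<bar>) else 0)"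
    if "s \<in> {0..len \<Gamma> e'}" for e' s
    using that d by (auto simp: tent_def edge_pt_def max_def)
  have "d \<le> l" if "walk \<Gamma> (Interior e t) y l" for l
  proof -
    have "\<bar>tent e t d (Interior e t :: ('v, 'e) point) - tent e t d y\<bar> \<le> 1 * l"
      by (rule walk_lip[where f="tent e t d" and K=1, OF _ that]) (auto simp: form max_def abs_if)
    then show ?thesis using ty tx by simp
  qed
  then show ?thesis using d by blast
qed

lemma sep2:
  assumes g: "metric_graph \<Gamma>" and ne: "v \<noteq> w"
  shows "\<exists>c>0. \<forall>l. walk \<Gamma> (Vertex v) (Vertex w) l \<longrightarrow> c \<le> l"
proof -
  define i where "i = (\<lambda>u. if u = v then 1 else (0::real))"
  define f where "f p = (case p of Vertex u \<Rightarrow> i u | Interior e s \<Rightarrow>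
      i (tail \<Gamma> e) + (i (head \<Gamma> e) - i (tail \<Gamma> e)) * s / len \<Gamma> e)" for p
  define K where "K = (\<Sum>e\<in>edges \<Gamma>. 1 / len \<Gamma> e) + 1"
  have pos: "len \<Gamma> e > 0" if "e \<in> edges \<Gamma>" for e using g that by (auto simp: metric_graph_def)
  have fin: "finite (edges \<Gamma>)" using g by (auto simp: metric_graph_def)
  have K0: "(\<Sum>e\<in>edges \<Gamma>. 1 / len \<Gamma> e) \<ge> 0" by (rule sum_nonneg) (use pos in \<open>auto simp: less_imp_le\<close>)
  then have Kp: "K > 0" by (simp add: K_def)
  have KL: "1 / len \<Gamma> e \<le> K" if "e \<in> edges \<Gamma>" for e
    using member_le_sum[OF that, of "\<lambda>e. 1 / len \<Gamma> e"] fin pos unfolding K_def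
    by (smt (verit) DiffE zero_le_divide_1_iff)
  have form: "f (edge_pt \<Gamma> e s) = i (tail \<Gamma> e) + (i (head \<Gamma> e) - i (tail \<Gamma> e)) * s / len \<Gamma> e"
    if "s \<in> {0..len \<Gamma> e}" "e \<in> edges \<Gamma>" for e s
    using that pos[of e] by (auto simp: f_def edge_pt_def)
  have lip: "\<bar>f (edge_pt \<Gamma> e t) - f (edge_pt \<Gamma> e s)\<bar> \<le> K * \<bar>t - s\<bar>"
    if e: "e \<in> edges \<Gamma>" and s: "s \<in> {0..len \<Gamma> e}" and t: "t \<in> {0..len \<Gamma> e}" for e s t
  proof -
    have "f (edge_pt \<Gamma> e t) - f (edge_pt \<Gamma> e s) = (i (head \<Gamma> e) - i (tail \<Gamma> e)) * ((1 / len \<Gamma> e) * (t - s))"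
      unfolding form[OF s e] form[OF t e] using pos[OF e] by (simp add: field_simps)
    then have "\<bar>f (edge_pt \<Gamma> e t) - f (edge_pt \<Gamma> e s)\<bar>
       = \<bar>i (head \<Gamma> e) - i (tail \<Gamma> e)\<bar> * ((1 / len \<Gamma> e) * \<bar>t - s\<bar>)"
      using pos[OF e] by (simp add: abs_mult)
    also have "\<dots> \<le> 1 * ((1 / len \<Gamma> e) * \<bar>t - s\<bar>)"
      using pos[OF e] by (intro mult_right_mono) (auto simp: i_def)
    also have "\<dots> \<le> K * \<bar>t - s\<bar>" using KL[OF e] by (simp only: mult_1) (intro mult_right_mono, auto)
    finally show ?thesis .
  qed
  have "1 / K \<le> l" if "walk \<Gamma> (Vertex v) (Vertex w) l" for l
  proof -
    have "\<bar>f (Vertex v) - f (Vertex w)\<bar> \<le> K * l" by (rule walk_lip[OF lip that])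
    then show ?thesis using ne Kp by (simp add: f_def i_def field_simps)
  qed
  then show ?thesis using Kp by (intro exI[of _ "1 / K"]) auto
qed

lemma Metric_space_gdist:
  assumes g: "metric_graph \<Gamma>"
  shows "Metric_space (points \<Gamma>) (gdist \<Gamma>)"
proof -
  let ?W = "\<lambda>x y. {l. walk \<Gamma> x y l}"
  have bdd: "bdd_below (?W x y)" for x y using walk_nonneg by (fastforce intro: bdd_belowI)
  have sym: "?W x y = ?W y x" for x y using walk_sym[OF g] by blast
  have ne: "?W x y \<noteq> {}" if "x \<in> points \<Gamma>" "y \<in> points \<Gamma>" for x y using walk_ex[OF g that] by auto
  have sep: "\<exists>c>0. \<forall>l. walk \<Gamma> x y l \<longrightarrow> c \<le> l"
    if "x \<in> points \<Gamma>" "y \<in> points \<Gamma>" "x \<noteq> y" for x y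
    using that sep1[OF g] sep2[OF g] walk_sym[OF g] by (cases x; cases y) (metis+)
  show ?thesis
  proof
    fix x y show "0 \<le> gdist \<Gamma> x y"
      by (cases "x \<in> points \<Gamma> \<and> y \<in> points \<Gamma>") (use ne[of x y] walk_nonneg[of \<Gamma> x y] in \<open>auto simp: gdist_def intro!: cInf_greatest\<close>)
    show "gdist \<Gamma> x y = gdist \<Gamma> y x" by (simp add: gdist_def sym)
  next
    fix x y assume xy: "x \<in> points \<Gamma>" "y \<in> points \<Gamma>"
    show "gdist \<Gamma> x y = 0 \<longleftrightarrow> x = y"
    proof
      assume "x = y"
      then have "0 \<in> ?W x y" using xy by (auto intro: walk.stay)
      then have "Inf (?W x y) \<le> 0" by (intro cInf_lower bdd) 
      moreover have "Inf (?W x y) \<ge> 0" using ne[OF xy] walk_nonneg[of \<Gamma> x y] by (intro cInf_greatest) auto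
      ultimately show "gdist \<Gamma> x y = 0" using xy by (simp add: gdist_def)
    next
      assume 0: "gdist \<Gamma> x y = 0"
      show "x = y"
      proof (rule ccontr)
        assume "x \<noteq> y"
        from sep[OF xy this] obtain c where "c > 0" "\<forall>l. walk \<Gamma> x y l \<longrightarrow> c \<le> l" by auto
        then have "c \<le> Inf (?W x y)" using ne[OF xy] by (intro cInf_greatest) auto
        then show False using \<open>c > 0\<close> 0 xy by (simp add: gdist_def)
      qed
    qed
  next
    fix x y z assume p: "x \<in> points \<Gamma>" "y \<in> points \<Gamma>" "z \<in> points \<Gamma>"
    have 1: "Inf (?W x z) \<le> l + k" if "walk \<Gamma> x y l" "walk \<Gamma> y z k" for l k
      using walk_trans[OF that(2,1)] by (intro cInf_lower bdd) auto
    have "Inf (?W x z) - k \<le> Inf (?W x y)" if "walk \<Gamma> y z k" for k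
      using ne[OF p(1,2)] 1[OF _ that] by (intro cInf_greatest) (auto simp: algebra_simps)
    then have "Inf (?W x z) - Inf (?W x y) \<le> Inf (?W y z)"
      using ne[OF p(2,3)] by (intro cInf_greatest) (auto simp: algebra_simps)
    then show "gdist \<Gamma> x z \<le> gdist \<Gamma> x y + gdist \<Gamma> y z" using p by (simp add: gdist_def)
  qed
qed

lemma outgoing_slope_unique:
  assumes "has_outgoing_slope \<Gamma> \<phi> \<zeta> s" "has_outgoing_slope \<Gamma> \<phi> \<zeta> s'" shows "s = s'"
proof -
  obtain e t \<sigma> where z: "\<zeta> = (e, t, \<sigma>)" by (cases \<zeta>)
  obtain a b where ab: "a > 0" "b > 0"
    "\<forall>h\<in>{0..a}. \<phi> (edge_pt \<Gamma> e (t + \<sigma> * h)) = \<phi> (edge_pt \<Gamma> e t) + of_int s * h"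
    "\<forall>h\<in>{0..b}. \<phi> (edge_pt \<Gamma> e (t + \<sigma> * h)) = \<phi> (edge_pt \<Gamma> e t) + of_int s' * h"
    using assms unfolding z has_outgoing_slope.simps by blast
  then have "of_int s * min a b = of_int s' * min a b"
    by (metis add_left_imp_eq atLeastAtMost_iff less_eq_real_def min.cobounded1 min.cobounded2 min_less_iff_conj)
  then show ?thesis using ab by auto
qed

end

theory Submission
  imports Defs
begin

text \<open>
  The graph is the interval of length \<open>n = card (ground M)\<close>, and \<open>D\<close> puts \<open>n\<close> chips on each of the
  points \<open>1, \<dots>, n - 1\<close>. It is the divisor of zeros of the tropical polynomial
  \<open>f\<^sub>0 t = min\<^sub>i (line\<^sub>i t)\<close> with one term for each element of \<open>M\<close>, so that the components of the
  complement of \<open>D\<close> are the loci where a single term is minimal. The series consists of the functions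
  \<open>f\<^sub>x - f\<^sub>0\<close> with \<open>f\<^sub>x t = min\<^sub>i (x\<^sub>i + line\<^sub>i t)\<close> and \<open>x\<close> in the tropical linear space of \<open>M\<close>, i.e. of
  the tropicalizations of the polynomials whose coefficient vector lies in a linear space representing
  \<open>M\<close>, if there is one.

  A polynomial with \<open>n\<close> terms has at most \<open>n - 1\<close> distinct zeros, whence \<open>D\<close> is nondegenerate, and the
  flats of \<open>M\<close> are the sets \<open>{i. x\<^sub>i > min x}\<close>. All slopes are multiples of \<open>n\<close>, so a zero of \<open>f\<^sub>x\<close>
  automatically has multiplicity at least \<open>n\<close>; vanishing at fewer than \<open>rank M\<close> prescribed points is
  therefore a matter of meeting fewer than \<open>rank M\<close> tropical hyperplanes, which a tropical analogue of
  Cramer's rule achieves. More than \<open>rank M\<close> vectors of the tropical linear space are tropically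
  dependent, and so are the corresponding functions.
\<close>

section \<open>The tropical linear space of a matroid\<close>

text \<open>If \<open>J \<union> {i}\<close> is a circuit with \<open>x\<close> minimal at \<open>i\<close>, the condition says that the minimum of \<open>x\<close> over
  this circuit is attained twice; no condition on larger dependent sets is added by stating it this way.\<close>
definition bergman :: "'a matroid_data \<Rightarrow> ('a \<Rightarrow> real) set" where
  "bergman M = {x. \<forall>J i. indep M J \<longrightarrow> i \<in> ground M \<longrightarrow> \<not> indep M (insert i J) \<longrightarrow> (\<exists>j\<in>J. x j \<le> x i)}"

lemma bergmanD:
  assumes "x \<in> bergman M" "indep M J" "i \<in> ground M" "\<not> indep M (insert i J)"
  obtains j where "j \<in> J" "x j \<le> x i"
  using assms unfolding bergman_def by blast

section \<open>Independent sets, rank and exchange\<close>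

lemma finite_ground: "matroid M \<Longrightarrow> finite (ground M)"
  by (simp add: matroid_def)

lemma indep_ground: "matroid M \<Longrightarrow> indep M X \<Longrightarrow> X \<subseteq> ground M"
  by (simp add: matroid_def)

lemma indep_empty: "matroid M \<Longrightarrow> indep M {}"
  by (simp add: matroid_def)

lemma indep_subset: "matroid M \<Longrightarrow> indep M Y \<Longrightarrow> X \<subseteq> Y \<Longrightarrow> indep M X"
  unfolding matroid_def by blast

lemma indep_augment:
  assumes "matroid M" "indep M X" "indep M Y" "card X < card Y"
  obtains y where "y \<in> Y" "y \<notin> X" "indep M (insert y X)"
  using assms unfolding matroid_def by blast

lemma indep_finite: "matroid M \<Longrightarrow> indep M X \<Longrightarrow> finite X"
  using finite_ground indep_ground finite_subset by metis

lemma indep_extend: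
  assumes m: "matroid M" and "indep M X" "indep M Y" "card X \<le> card Y"
  obtains Z where "indep M Z" "X \<subseteq> Z" "Z \<subseteq> X \<union> Y" "card Z = card Y"
proof -
  have "\<exists>Z. indep M Z \<and> X \<subseteq> Z \<and> Z \<subseteq> X \<union> Y \<and> card Z = card Y"
    using assms(2,4)
  proof (induction "card Y - card X" arbitrary: X)
    case 0
    then show ?case using assms(3) by (intro exI[of _ X]) auto
  next
    case (Suc k)
    then have "card X < card Y" by simp
    then obtain y where y: "y \<in> Y" "y \<notin> X" "indep M (insert y X)"
      using indep_augment[OF m Suc.prems(1) assms(3)] by blast
    have "card (insert y X) = Suc (card X)" using y indep_finite[OF m Suc.prems(1)] by simp
    then have "\<exists>Z. indep M Z \<and> insert y X \<subseteq> Z \<and> Z \<subseteq> insert y X \<union> Y \<and> card Z = card Y"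
      using Suc y by (intro Suc.hyps(1)) auto
    then show ?case using y by blast
  qed
  then show thesis using that by blast
qed

lemma finite_indep_cards: "matroid M \<Longrightarrow> finite {card Y | Y. Y \<subseteq> X \<and> indep M Y}"
  by (rule finite_subset[of _ "card ` Pow (ground M)"])
    (auto simp: finite_ground dest: indep_ground)

lemma card_le_mrank: "matroid M \<Longrightarrow> Y \<subseteq> X \<Longrightarrow> indep M Y \<Longrightarrow> card Y \<le> mrank M X"
  unfolding mrank_def by (rule Max_ge) (auto simp: finite_indep_cards)

lemma mrank_attained:
  assumes "matroid M"
  obtains Y where "Y \<subseteq> X" "indep M Y" "card Y = mrank M X"
proof -
  have "mrank M X \<in> {card Y | Y. Y \<subseteq> X \<and> indep M Y}"
    unfolding mrank_def
    by (rule Max_in) (use assms in \<open>auto simp: finite_indep_cards intro: indep_empty\<close>)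
  then show thesis using that by auto
qed

text \<open>A larger independent subset of \<open>X\<close> would augment \<open>J\<close> inside
  \<open>X\<close>.\<close>

lemma mrank_maximal:
  assumes m: "matroid M" and "J \<subseteq> X" "indep M J" and max: "\<And>i. i \<in> X - J \<Longrightarrow> \<not> indep M (insert i J)"
  shows "mrank M X = card J"
proof (rule antisym)
  show "card J \<le> mrank M X" using assms card_le_mrank by blast
  obtain Y where Y: "Y \<subseteq> X" "indep M Y" "card Y = mrank M X" using mrank_attained[OF m] by blast
  show "mrank M X \<le> card J"
  proof (rule ccontr)
    assume "\<not> ?thesis"
    then obtain y where "y \<in> Y" "y \<notin> J" "indep M (insert y J)"
      using indep_augment[OF m \<open>indep M J\<close> Y(2)] Y(3) by auto
    then show False using max Y by blast
  qed
qed

text \<open>If every element of \<open>J'\<close> lies in the closure of \<open>J\<close>, then so does everything in the closure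
  of \<open>J'\<close>.\<close>
lemma indep_exchange:
  assumes m: "matroid M" and J: "indep M (insert i J)" "i \<notin> J"
    and J': "indep M J'" "\<not> indep M (insert i J')"
  obtains j where "j \<in> J'" "j \<notin> J" "indep M (insert j J)"
proof -
  have iJ: "indep M J" using indep_subset[OF m J(1)] by blast
  have c: "card (insert i J) = Suc (card J)" using J indep_finite[OF m iJ] by simp
  have "\<exists>j\<in>J'. j \<notin> J \<and> indep M (insert j J)"
  proof (cases "card J < card J'")
    case True
    then show ?thesis using indep_augment[OF m iJ J'(1)] by blast
  next
    \<comment> \<open>\<open>J'\<close> is too small to augment \<open>J\<close>, so it is first
      enlarged by elements of \<open>insert i J\<close>. The element \<open>i\<close> cannot be
      among them, as it lies in the closure of \<open>J'\<close>; hence the element that augments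
      \<open>J\<close> comes from \<open>J'\<close>.\<close>
    case False
    then have "card J' \<le> card (insert i J)" using c by simp
    from indep_extend[OF m J'(1) J(1) this] obtain Z where
      Z: "indep M Z" "J' \<subseteq> Z" "Z \<subseteq> J' \<union> insert i J" "card Z = Suc (card J)" using c by metis
    have "i \<notin> Z" using Z J' indep_subset[OF m Z(1), of "insert i J'"] by auto
    moreover obtain z where "z \<in> Z" "z \<notin> J" "indep M (insert z J)"
      using indep_augment[OF m iJ Z(1)] Z(4) by auto
    ultimately show ?thesis using Z(3) by blast
  qed
  then show thesis using that by blast
qed

section \<open>Closure properties of the tropical linear space, and its relation to flats and
  bases\<close>

text \<open>This is where looplessness enters: a loop would violate the condition in
  \<open>bergman\<close> with \<open>J\<close> empty, for every vector.\<close>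

lemma bergman_nonempty_circuit:
  assumes "loopless M" "i \<in> ground M" "\<not> indep M (insert i J)"
  shows "J \<noteq> {}"
  using assms by (auto simp: loopless_def)

lemma bergman_const: "loopless M \<Longrightarrow> (\<lambda>_. c) \<in> bergman M"
  unfolding bergman_def using bergman_nonempty_circuit by fastforce

lemma bergman_add: "x \<in> bergman M \<Longrightarrow> (\<lambda>i. x i + c) \<in> bergman M"
  unfolding bergman_def by simp

text \<open>For each \<open>i\<close> the vector attaining the minimum there supplies
  \<open>j\<close>, and at \<open>j\<close> the minimum can only be smaller.\<close>

lemma bergman_Min:
  assumes "finite H" "H \<noteq> {}" "\<And>h. h \<in> H \<Longrightarrow> x h \<in> bergman M"
  shows "(\<lambda>i. Min ((\<lambda>h. x h i) ` H)) \<in> bergman M"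
  unfolding bergman_def
proof (intro CollectI allI impI)
  fix J i assume J: "indep M J" "i \<in> ground M" "\<not> indep M (insert i J)"
  have "Min ((\<lambda>h. x h i) ` H) \<in> (\<lambda>h. x h i) ` H" using assms by (intro Min_in) auto
  then obtain h where h: "h \<in> H" "Min ((\<lambda>h. x h i) ` H) = x h i" by auto
  obtain j where "j \<in> J" "x h j \<le> x h i" using bergmanD[OF assms(3)[OF h(1)] J] .
  then show "\<exists>j\<in>J. Min ((\<lambda>h. x h j) ` H) \<le> Min ((\<lambda>h. x h i) ` H)"
    using h assms by (intro bexI[of _ j]) (auto simp: Min_le_iff)
qed

lemma bergman_min:
  assumes "x \<in> bergman M" "y \<in> bergman M"
  shows "(\<lambda>i. min (x i) (y i)) \<in> bergman M"
  unfolding bergman_def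
proof (intro CollectI allI impI)
  fix J i assume J: "indep M J" "i \<in> ground M" "\<not> indep M (insert i J)"
  obtain j where "j \<in> J" "x j \<le> x i" using bergmanD[OF assms(1) J] .
  moreover obtain j' where "j' \<in> J" "y j' \<le> y i" using bergmanD[OF assms(2) J] .
  ultimately show "\<exists>j\<in>J. min (x j) (y j) \<le> min (x i) (y i)"
    by (metis min.coboundedI1 min.coboundedI2 min_def)
qed

text \<open>The condition only compares coordinates, so it survives a monotone function, here a
  threshold. Such two-valued vectors will generate the series.\<close>

lemma bergman_level:
  assumes "loopless M" "x \<in> bergman M" "T \<ge> 0"
  shows "(\<lambda>i. if x i > c then T else 0) \<in> bergman M"
  unfolding bergman_def
proof (intro CollectI allI impI)
  fix J i assume J: "indep M J" "i \<in> ground M" "\<not> indep M (insert i J)"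
  obtain j where "j \<in> J" "x j \<le> x i" using bergmanD[OF assms(2) J] .
  then show "\<exists>j\<in>J. (if x j > c then T else 0) \<le> (if x i > c then T else 0)"
    using assms(3) by (intro bexI[of _ j]) auto
qed

text \<open>All values on a maximum independent \<open>J\<close> in the level set exceed
  \<open>c\<close>; an outside element spanned by \<open>J\<close> would need some \<open>j\<close>
  in \<open>J\<close> with a value at most its own.\<close>

lemma bergman_flat:
  assumes m: "matroid M" and x: "x \<in> bergman M"
  shows "flat M {i \<in> ground M. x i > c}" (is "flat M ?F")
  unfolding flat_def
proof (intro conjI ballI)
  fix i assume i: "i \<in> ground M - ?F"
  obtain J where J: "J \<subseteq> ?F" "indep M J" "card J = mrank M ?F" using mrank_attained[OF m] .
  have "indep M (insert i J)"
  proof (rule ccontr)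
    assume "\<not> ?thesis"
    then obtain j where "j \<in> J" "x j \<le> x i" using bergmanD[OF x J(2)] i by blast
    then show False using i J by auto
  qed
  moreover have "card (insert i J) = Suc (card J)" using i J indep_finite[OF m J(2)] by (subst card_insert_disjoint) auto
  ultimately show "mrank M ?F < mrank M (insert i ?F)"
    using card_le_mrank[OF m insert_mono[OF J(1), of i]] J(3) by simp
qed auto

text \<open>The condition could fail only for some \<open>J\<close> inside \<open>F\<close> that
  spans an element outside \<open>F\<close>, and a flat has no such \<open>J\<close>.\<close>

lemma flat_bergman:
  assumes m: "matroid M" and l: "loopless M" and F: "flat M F"
  shows "(\<lambda>i. if i \<in> F then 1 else 0) \<in> bergman M"
  unfolding bergman_def
proof (intro CollectI allI impI)
  fix J i assume J: "indep M J" "i \<in> ground M" "\<not> indep M (insert i J)"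
  show "\<exists>j\<in>J. (if j \<in> F then 1 else 0) \<le> (if i \<in> F then 1 else (0::real))"
  proof (rule ccontr)
    assume c: "\<not> ?thesis"
    have "J \<noteq> {}" using bergman_nonempty_circuit[OF l J(2,3)] .
    then have JF: "i \<notin> F" "J \<subseteq> F" using c by (auto split: if_splits)
    obtain Y where Y: "Y \<subseteq> F" "indep M Y" "card Y = mrank M F" using mrank_attained[OF m] .
    then obtain Z where Z: "indep M Z" "J \<subseteq> Z" "Z \<subseteq> J \<union> Y" "card Z = mrank M F"
      using indep_extend[OF m J(1) Y(2)] card_le_mrank[OF m JF(2) J(1)] by metis
    have ZF: "Z \<subseteq> F" using Z Y JF by blast
    \<comment> \<open>\<open>Z\<close> is a basis of \<open>F\<close> containing \<open>J\<close>,
      and \<open>J\<close> spans \<open>i\<close>; so \<open>Z\<close> is also maximal in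
      \<open>insert i F\<close>.\<close>
    have "\<not> indep M (insert k Z)" if "k \<in> insert i F - Z" for k
    proof
      assume k: "indep M (insert k Z)"
      show False
      proof (cases "k = i")
        case True
        then show False using indep_subset[OF m k, of "insert i J"] Z J by blast
      next
        case False
        then have "card (insert k Z) \<le> mrank M F" using that ZF k by (intro card_le_mrank[OF m]) auto
        then show False using that Z indep_finite[OF m Z(1)] by simp
      qed
    qed
    then have "mrank M (insert i F) = card Z" using ZF Z by (intro mrank_maximal[OF m]) auto
    moreover have "mrank M F < mrank M (insert i F)" using F J(2) JF by (auto simp: flat_def)
    ultimately show False using Z by simp
  qed
qed

text \<open>A basis spans every element outside it, so each vector takes its minimum over the ground
  set on the basis. Both rank computations rest on this.\<close>

lemma basis_dominates:
  assumes m: "matroid M" and I: "indep M I" "card I = mrank M (ground M)"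
    and x: "x \<in> bergman M" and i: "i \<in> ground M"
  obtains k where "k \<in> I" "x k \<le> x i"
proof (cases "i \<in> I")
  case False
  have "\<not> indep M (insert i I)"
    using card_le_mrank[OF m indep_ground[OF m], of "insert i I"] False I indep_finite[OF m I(1)] by auto
  then show thesis using bergmanD[OF x I(1) i] that by blast
qed (use that in auto)

text \<open>For a basis \<open>I\<close> these vectors, one for each \<open>k\<close>, form a matrix
  on \<open>I\<close> with \<open>0\<close> on the diagonal and \<open>T\<close> elsewhere; they
  will give the independent functions.\<close>

lemma bergman_separating:
  assumes m: "matroid M" and l: "loopless M" and I: "indep M I" "k \<in> I" and T: "T \<ge> 0"
  obtains x where "x \<in> bergman M" "x k = 0" "\<And>i. i \<in> I - {k} \<Longrightarrow> x i = T"
proof -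
  define J where "J = I - {k}"
  \<comment> \<open>The vector is \<open>T\<close> on the closure of \<open>I - {k}\<close> and
    \<open>0\<close> off it; \<open>indep_exchange\<close> says that this closure spans nothing
    new.\<close>
  define x where "x i = (if i \<notin> J \<and> indep M (insert i J) then 0 else T)" for i
  have "x \<in> bergman M"
    unfolding bergman_def
  proof (intro CollectI allI impI)
    fix J' i assume J': "indep M J'" "i \<in> ground M" "\<not> indep M (insert i J')"
    show "\<exists>j\<in>J'. x j \<le> x i"
    proof (cases "i \<notin> J \<and> indep M (insert i J)")
      case True
      then obtain j where "j \<in> J'" "j \<notin> J" "indep M (insert j J)"
        using indep_exchange[OF m] J' by metis
      then show ?thesis using T by (intro bexI[of _ j]) (auto simp: x_def)
    next
      case False
      then have "x j \<le> x i" for j using T by (auto simp: x_def)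
      then show ?thesis using bergman_nonempty_circuit[OF l J'(2,3)] by blast
    qed
  qed
  moreover have "x k = 0" using I by (simp add: x_def J_def insert_absorb)
  ultimately show thesis using that[of x] by (simp add: x_def J_def)
qed

text \<open>The coordinates of the solution are tropical maximal minors, as in Cramer's rule; exchanging
  the roles of \<open>i\<close> and \<open>\<tau> q\<close> in an optimal assignment \<open>\<tau>\<close> produces the second minimizer.\<close>
lemma bergman_meets_hyperplanes:
  fixes h :: "'q \<Rightarrow> 'a \<Rightarrow> real"
  assumes m: "matroid M" and l: "loopless M" and Q: "finite Q" "card Q < mrank M (ground M)"
  obtains x where "x \<in> bergman M"
    "\<And>q. q \<in> Q \<Longrightarrow> \<exists>i\<in>ground M. \<exists>j\<in>ground M. i \<noteq> j \<and> x i + h q i = x j + h q j \<and>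
       (\<forall>k\<in>ground M. x i + h q i \<le> x k + h q k)"
proof -
  \<comment> \<open>\<open>A i\<close> indexes the terms of the minor for coordinate
    \<open>i\<close>: the rows \<open>Q\<close> receive distinct columns that are independent
    together with \<open>i\<close>. The weight of a term is \<open>w\<close>.\<close>
  define A where "A i = {\<tau> \<in> Q \<rightarrow>\<^sub>E ground M. inj_on \<tau> Q \<and> i \<notin> \<tau> ` Q \<and> indep M (insert i (\<tau> ` Q))}" for i
  define w where "w \<tau> = (\<Sum>q\<in>Q. h q (\<tau> q))" for \<tau>
  define x where "x i = Min (w ` A i)" for i
  have fA: "finite (A i)" for i
    unfolding A_def
    by (rule finite_subset[OF _ finite_PiE[OF Q(1), of "\<lambda>_. ground M"]]) (use finite_ground[OF m] in auto)
  have neA: "A i \<noteq> {}" if i: "i \<in> ground M" for i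
  proof -
    have "indep M {i}" using l i by (simp add: loopless_def)
    obtain I where "I \<subseteq> ground M" and I: "indep M I" "card I = mrank M (ground M)" using mrank_attained[OF m] .
    have "card {i} \<le> card I" using Q(2) I by simp
    then obtain Z where Z: "indep M Z" "i \<in> Z" "card Z = card I"
      using indep_extend[OF m \<open>indep M {i}\<close> I(1)] by (metis insert_subset)
    have "card Q \<le> card (Z - {i})" using Z Q I indep_finite[OF m Z(1)] by simp
    then obtain \<tau> where t: "\<tau> ` Q \<subseteq> Z - {i}" "inj_on \<tau> Q"
      using card_le_inj[OF Q(1), of "Z - {i}"] indep_finite[OF m Z(1)] by (meson finite_Diff)
    have "restrict \<tau> Q \<in> A i"
      unfolding A_def
    proof (intro CollectI conjI)
      show "restrict \<tau> Q \<in> Q \<rightarrow>\<^sub>E ground M" using t indep_ground[OF m Z(1)] by auto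
      show "inj_on (restrict \<tau> Q) Q" using t by (simp add: inj_on_restrict_eq)
      show "i \<notin> restrict \<tau> Q ` Q" using t by auto
      show "indep M (insert i (restrict \<tau> Q ` Q))" using t Z(2) by (intro indep_subset[OF m Z(1)]) auto
    qed
    then show ?thesis by blast
  qed
  have le: "x i \<le> w \<tau>" if "\<tau> \<in> A i" for i \<tau>
    unfolding x_def using that fA by (intro Min_le) auto
  have att: "\<exists>\<tau>\<in>A i. x i = w \<tau>" if "i \<in> ground M" for i
  proof -
    have "x i \<in> w ` A i" unfolding x_def using that fA neA by (intro Min_in) auto
    then show ?thesis by auto
  qed
  have xB: "x \<in> bergman M"
    unfolding bergman_def
  proof (intro CollectI allI impI)
    fix J i assume J: "indep M J" "i \<in> ground M" "\<not> indep M (insert i J)"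
    obtain \<tau> where t: "\<tau> \<in> A i" "x i = w \<tau>" using att[OF J(2)] by blast
    \<comment> \<open>In an optimal term for \<open>i\<close>, the omitted column \<open>i\<close>
      is exchanged for some \<open>j\<close> in \<open>J\<close> without change of weight.\<close>
    obtain j where "j \<in> J" "j \<notin> \<tau> ` Q" "indep M (insert j (\<tau> ` Q))"
      using indep_exchange[OF m _ _ J(1,3), of "\<tau> ` Q"] t by (auto simp: A_def)
    then have "\<tau> \<in> A j" using t by (auto simp: A_def)
    then show "\<exists>j\<in>J. x j \<le> x i" using le t \<open>j \<in> J\<close> by metis
  qed
  have swap: "\<exists>j\<in>ground M. j \<noteq> i \<and> x j + h q j \<le> x i + h q i" if q: "q \<in> Q" and i: "i \<in> ground M" for q i
  proof -
    obtain \<tau> where t: "\<tau> \<in> A i" "x i = w \<tau>" using att[OF i] by blast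
    \<comment> \<open>Row \<open>q\<close> receives \<open>i\<close> and releases
      \<open>\<tau> q\<close>. The columns together with the omitted one form the same set, and the
      weight changes only in row \<open>q\<close>.\<close>
    let ?\<tau> = "\<tau>(q := i)"
    have inj: "inj_on \<tau> Q" "i \<notin> \<tau> ` Q" and e: "\<tau> \<in> Q \<rightarrow>\<^sub>E ground M" using t by (auto simp: A_def)
    have im: "\<tau> ` Q = insert (\<tau> q) (\<tau> ` (Q - {q}))" using q by blast
    have im': "?\<tau> ` Q = insert i (\<tau> ` (Q - {q}))" using q by auto
    have "\<tau> q \<notin> \<tau> ` (Q - {q})" using inj q by (auto dest: inj_onD)
    moreover have "inj_on ?\<tau> Q" using inj q by (auto simp: inj_on_def)
    moreover have "?\<tau> \<in> Q \<rightarrow>\<^sub>E ground M" using e q i by (auto simp: PiE_iff extensional_def)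
    moreover have "\<tau> q \<noteq> i" using inj q by auto
    moreover have "indep M (insert (\<tau> q) (insert i (\<tau> ` (Q - {q}))))"
      using t(1) unfolding A_def mem_Collect_eq im by (simp only: insert_commute)
    ultimately have "?\<tau> \<in> A (\<tau> q)"
      unfolding A_def mem_Collect_eq im' by blast
    then have "x (\<tau> q) \<le> w ?\<tau>" by (rule le)
    also have "w ?\<tau> = h q i + (\<Sum>p\<in>Q - {q}. h p (\<tau> p))"
    proof -
      have "w ?\<tau> = h q (?\<tau> q) + (\<Sum>p\<in>Q - {q}. h p (?\<tau> p))" unfolding w_def by (rule sum.remove[OF Q(1) q])
      moreover have "(\<Sum>p\<in>Q - {q}. h p (?\<tau> p)) = (\<Sum>p\<in>Q - {q}. h p (\<tau> p))" by (rule sum.cong) auto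
      ultimately show ?thesis by simp
    qed
    also have "\<dots> = h q i + (w \<tau> - h q (\<tau> q))"
      using sum.remove[OF Q(1) q, of "\<lambda>p. h p (\<tau> p)"] by (simp add: w_def)
    finally have "x (\<tau> q) + h q (\<tau> q) \<le> x i + h q i" using t by simp
    moreover have "\<tau> q \<in> ground M" using e q by auto
    ultimately show ?thesis using \<open>\<tau> q \<noteq> i\<close> by blast
  qed
  have ne: "ground M \<noteq> {}"
  proof
    assume "ground M = {}"
    moreover obtain I where "I \<subseteq> ground M" "card I = mrank M (ground M)" using mrank_attained[OF m] by blast
    ultimately show False using Q(2) by auto
  qed
  show thesis
  proof (rule that[OF xB])
    fix q assume q: "q \<in> Q"
    have "Min ((\<lambda>i. x i + h q i) ` ground M) \<in> (\<lambda>i. x i + h q i) ` ground M"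
      using ne finite_ground[OF m] by (intro Min_in) auto
    then obtain i where i: "i \<in> ground M" "Min ((\<lambda>i. x i + h q i) ` ground M) = x i + h q i" by auto
    have min: "x i + h q i \<le> x k + h q k" if "k \<in> ground M" for k
      using i(2) Min_le[of "(\<lambda>i. x i + h q i) ` ground M" "x k + h q k"] that finite_ground[OF m] by auto
    \<comment> \<open>At a minimizer \<open>i\<close> the exchange gives another element with no
      larger value, hence a tie.\<close>
    obtain j where "j \<in> ground M" "j \<noteq> i" "x j + h q j \<le> x i + h q i" using swap[OF q i(1)] by blast
    then show "\<exists>i\<in>ground M. \<exists>j\<in>ground M. i \<noteq> j \<and> x i + h q i = x j + h q j \<and>
       (\<forall>k\<in>ground M. x i + h q i \<le> x k + h q k)"
      using i(1) min[of j] min by (intro bexI[of _ i] bexI[of _ j]) force+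
  qed
qed

section \<open>Tropical dependence beyond the rank\<close>

text \<open>The peak \<open>c k\<close> is a coordinate where \<open>x k\<close> is minimal in the
  family. The condition \<open>tri\<close> is triangularity: in each subfamily some member is
  strictly above every other one at that one's peak.\<close>

lemma indep_of_peaks:
  fixes x :: "'k \<Rightarrow> 'a \<Rightarrow> real"
  assumes m: "matroid M" and K: "finite K" and x: "\<And>k. k \<in> K \<Longrightarrow> x k \<in> bergman M"
    and c: "\<And>k. k \<in> K \<Longrightarrow> c k \<in> ground M"
    and att: "\<And>k l. k \<in> K \<Longrightarrow> l \<in> K \<Longrightarrow> x k (c k) \<le> x l (c k)"
    and tri: "\<And>Z. Z \<subseteq> K \<Longrightarrow> Z \<noteq> {} \<Longrightarrow> \<exists>z\<in>Z. \<forall>k\<in>Z - {z}. x k (c k) < x z (c k)"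
  shows "indep M (c ` K) \<and> inj_on c K"
proof
  show "inj_on c K"
  proof (rule inj_onI, rule ccontr)
    fix k l assume kl: "k \<in> K" "l \<in> K" "c k = c l" "k \<noteq> l"
    then obtain z where "z \<in> {k, l}" "\<forall>k\<in>{k, l} - {z}. x k (c k) < x z (c k)" using tri[of "{k, l}"] by auto
    then have "x k (c k) < x l (c k) \<or> x l (c l) < x k (c l)" using kl(4) by blast
    then show False using kl att[of k l] att[of l k] by auto
  qed
  have "indep M (c ` Z)" if "Z \<subseteq> K" for Z
    using finite_subset[OF that K] that
  proof (induction rule: finite_psubset_induct)
    case (psubset Z)
    show ?case
    proof (cases "Z = {}")
      case False
      define v where "v k = x k (c k)" for k
      \<comment> \<open>The member \<open>z\<close> to split off is taken among those of lowest peak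
        value. If the other peaks spanned \<open>c z\<close>, some \<open>l\<close> would satisfy
        \<open>x z (c l) \<le> v z\<close>; for \<open>l\<close> in \<open>Y\<close> this
        contradicts \<open>tri\<close>, and otherwise \<open>v z < v l\<close> and
        \<open>att\<close>.\<close>
      define Y where "Y = {k \<in> Z. v k = Min (v ` Z)}"
      have "Min (v ` Z) \<in> v ` Z" using False psubset.hyps by (intro Min_in) auto
      then have "Y \<noteq> {}" by (auto simp: Y_def)
      then obtain z where z: "z \<in> Y" "\<forall>k\<in>Y - {z}. x k (c k) < x z (c k)"
        using tri[of Y] psubset.prems by (auto simp: Y_def)
      then have zZ: "z \<in> Z" by (simp add: Y_def)
      have I: "indep M (c ` (Z - {z}))" using zZ psubset by (intro psubset.IH) auto
      have "indep M (insert (c z) (c ` (Z - {z})))"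
      proof (rule ccontr)
        assume d: "\<not> ?thesis"
        have "x z \<in> bergman M" "c z \<in> ground M" using x c zZ psubset.prems by auto
        then obtain l where l: "l \<in> Z - {z}" "x z (c l) \<le> x z (c z)" using bergmanD[OF _ I _ d] by blast
        have vz: "v z = Min (v ` Z)" using z by (simp add: Y_def)
        have vl: "Min (v ` Z) \<le> v l" using l psubset.hyps by simp
        show False
        proof (cases "l \<in> Y")
          case True
          then show False using z(2) l vz by (force simp: Y_def v_def)
        next
          case False
          then have "v z < v l" using vz vl l by (simp add: Y_def)
          moreover have "v l \<le> x z (c l)" unfolding v_def using att[of l z] l zZ psubset.prems by auto
          ultimately show False using l by (simp add: v_def)
        qed
      qed
      then show ?thesis using zZ by (metis image_insert insert_Diff)
    qed (use indep_empty[OF m] in simp)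
  qed
  then show "indep M (c ` K)" by simp
qed

text \<open>Elements are removed one by one, each with a value that works against all those still
  present. In any \<open>Z\<close> the element removed last serves as \<open>z\<close>, since it was
  present when the others were removed.\<close>

lemma triangular_choice:
  assumes K: "finite K"
    and step: "\<And>Z. Z \<subseteq> K \<Longrightarrow> Z \<noteq> {} \<Longrightarrow> \<exists>k\<in>Z. \<exists>i. A k i \<and> (\<forall>l\<in>Z - {k}. S k i l)"
  obtains c where "\<And>k. k \<in> K \<Longrightarrow> A k (c k)"
    "\<And>Z. Z \<subseteq> K \<Longrightarrow> Z \<noteq> {} \<Longrightarrow> \<exists>z\<in>Z. \<forall>k\<in>Z - {z}. S k (c k) z"
proof -
  have "\<exists>c. (\<forall>k\<in>Y. A k (c k)) \<and> (\<forall>Z. Z \<subseteq> Y \<longrightarrow> Z \<noteq> {} \<longrightarrow> (\<exists>z\<in>Z. \<forall>k\<in>Z - {z}. S k (c k) z))"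
    if "Y \<subseteq> K" for Y
    using finite_subset[OF that K] that
  proof (induction rule: finite_psubset_induct)
    case (psubset Y)
    show ?case
    proof (cases "Y = {}")
      case False
      then obtain k i where k: "k \<in> Y" "A k i" "\<forall>l\<in>Y - {k}. S k i l" using step psubset by metis
      then obtain c where c: "\<forall>k\<in>Y - {k}. A k (c k)"
        "\<forall>Z. Z \<subseteq> Y - {k} \<longrightarrow> Z \<noteq> {} \<longrightarrow> (\<exists>z\<in>Z. \<forall>k\<in>Z - {z}. S k (c k) z)"
        using psubset.IH[of "Y - {k}"] psubset.prems by blast
      let ?c = "c(k := i)"
      have "\<exists>z\<in>Z. \<forall>j\<in>Z - {z}. S j (?c j) z" if Z: "Z \<subseteq> Y" "Z \<noteq> {}" for Z
      proof (cases "Z = {k}")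
        case False
        then have "Z - {k} \<noteq> {}" "Z - {k} \<subseteq> Y - {k}" using Z by auto
        then obtain z where "z \<in> Z - {k}" "\<forall>j\<in>Z - {k} - {z}. S j (c j) z" using c(2) by metis
        then show ?thesis using k Z by (intro bexI[of _ z]) auto
      qed auto
      moreover have "\<forall>j\<in>Y. A j (?c j)" using c k by auto
      ultimately show ?thesis by blast
    qed simp
  qed
  from this[of K] show thesis using that by blast
qed

text \<open>Normalize \<open>b k0 = 0\<close> and take the least \<open>b\<close> for which no \<open>k \<noteq> k0\<close> is ever the unique
  minimizer. If \<open>k0\<close> were the unique minimizer somewhere, then, as no set of the remaining \<open>b k\<close>
  can be lowered, peaks as in \<open>indep_of_peaks\<close> could be chosen for all \<open>k\<close>.\<close>
lemma bergman_dependent: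
  fixes x :: "'k \<Rightarrow> 'a \<Rightarrow> real"
  assumes m: "matroid M" and K: "finite K" "card K > mrank M (ground M)"
    and x: "\<And>k. k \<in> K \<Longrightarrow> x k \<in> bergman M"
  obtains b where "\<forall>i\<in>ground M. \<exists>k\<in>K. \<exists>l\<in>K. k \<noteq> l \<and> x k i + b k = x l i + b l \<and>
       (\<forall>j\<in>K. x k i + b k \<le> x j i + b j)"
proof -
  let ?E = "ground M"
  have fE: "finite ?E" using finite_ground[OF m] .
  obtain k0 where k0: "k0 \<in> K" using K by (metis card.empty ex_in_conv not_less_zero)
  define C where "C = (\<Sum>k\<in>K. \<Sum>i\<in>?E. \<bar>x k i\<bar>)"
  have C: "\<bar>x k i\<bar> \<le> C" if "k \<in> K" "i \<in> ?E" for k i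
  proof -
    have "\<bar>x k i\<bar> \<le> (\<Sum>i\<in>?E. \<bar>x k i\<bar>)" using that fE by (intro member_le_sum) auto
    also have "\<dots> \<le> C" unfolding C_def using that K by (intro member_le_sum) (auto intro: sum_nonneg)
    finally show ?thesis .
  qed
  have C0: "C \<ge> 0" unfolding C_def by (intro sum_nonneg) auto
  \<comment> \<open>The bound \<open>- (2 * C + 1)\<close> makes the infima below exist; in the case
    to be refuted it is not attained.\<close>
  define B where "B = {b. b k0 = 0 \<and> (\<forall>k\<in>K - {k0}. - (2 * C + 1) \<le> b k \<and>
     (\<forall>i\<in>?E. \<exists>l\<in>K - {k}. b l + x l i \<le> b k + x k i))}"
  \<comment> \<open>With all others raised by \<open>2 * C\<close>, \<open>k0\<close> is a minimizer
    at every coordinate.\<close>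
  have "(\<lambda>k. if k = k0 then 0 else 2 * C) \<in> B"
    unfolding B_def
  proof (intro CollectI conjI ballI)
    fix k i assume "k \<in> K - {k0}" "i \<in> ?E"
    then show "\<exists>l\<in>K - {k}. (if l = k0 then 0 else 2 * C) + x l i \<le> (if k = k0 then 0 else 2 * C) + x k i"
      using C[of k0 i] C[of k i] k0 by (intro bexI[of _ k0]) auto
  qed (use C0 in auto)
  then have Bne: "B \<noteq> {}" by blast
  define b where "b k = (if k \<in> K - {k0} then Inf ((\<lambda>b. b k) ` B) else 0)" for k
  have bdd: "bdd_below ((\<lambda>b. b k) ` B)" if "k \<in> K" for k
    using that by (intro bdd_belowI[of _ "- (2 * C + 1)"]) (use C0 in \<open>auto simp: B_def\<close>)
  have low: "b k \<le> b' k" if "k \<in> K" "b' \<in> B" for k b'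
    using that bdd by (cases "k = k0") (auto simp: b_def B_def intro!: cInf_lower)
  have bk: "- (2 * C + 1) \<le> b k" if "k \<in> K - {k0}" for k
    using that Bne by (auto simp: b_def B_def intro!: cInf_greatest)
  \<comment> \<open>The coordinatewise infimum inherits the constraint: otherwise some
    \<open>b'\<close> in \<open>B\<close> has \<open>b' k\<close> below the threshold
    \<open>v\<close>, and as its other coordinates are at least those of \<open>b\<close>, it
    violates the constraint itself.\<close>
  have bc: "\<exists>l\<in>K - {k}. b l + x l i \<le> b k + x k i" if k: "k \<in> K - {k0}" and i: "i \<in> ?E" for k i
  proof (rule ccontr)
    assume c: "\<not> ?thesis"
    define v where "v = Min ((\<lambda>l. b l + x l i) ` (K - {k})) - x k i"
    have ne: "K - {k} \<noteq> {}" using k k0 by auto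
    have "\<forall>l\<in>K - {k}. b k + x k i < b l + x l i" using c by (simp add: not_le)
    then have "b k < v" unfolding v_def using ne K(1) by (subst less_diff_eq, subst Min_gr_iff) auto
    then obtain b' where b': "b' \<in> B" "b' k < v"
      using k Bne bdd[of k] by (auto simp: b_def cInf_less_iff)
    then obtain l where l: "l \<in> K - {k}" "b' l + x l i \<le> b' k + x k i" using k i by (auto simp: B_def)
    have "v \<le> b l + x l i - x k i" unfolding v_def using l K(1) by simp
    then show False using low[of l b'] l b' by simp
  qed
  show thesis
  proof (rule that[of b], rule ballI, rule ccontr)
    fix i0 assume i0: "i0 \<in> ?E" and no: "\<not> (\<exists>k\<in>K. \<exists>l\<in>K. k \<noteq> l \<and> x k i0 + b k = x l i0 + b l \<and>
       (\<forall>j\<in>K. x k i0 + b k \<le> x j i0 + b j))"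
    have "Min ((\<lambda>k. x k i0 + b k) ` K) \<in> (\<lambda>k. x k i0 + b k) ` K" using k0 K by (intro Min_in) auto
    then obtain k1 where k1: "k1 \<in> K" "Min ((\<lambda>k. x k i0 + b k) ` K) = x k1 i0 + b k1" by auto
    have k1m: "x k1 i0 + b k1 \<le> x j i0 + b j" if "j \<in> K" for j
      using k1(2) Min_le[of "(\<lambda>k. x k i0 + b k) ` K" "x j i0 + b j"] that K(1) by auto
    have "k1 = k0"
    proof (rule ccontr)
      assume "k1 \<noteq> k0"
      then obtain l where "l \<in> K - {k1}" "b l + x l i0 \<le> b k1 + x k1 i0" using bc[of k1 i0] k1 i0 by blast
      then show False using no k1 k1m[of l] k1m by (auto simp: add.commute)
    qed
    then have s0: "x k0 i0 + b k0 < x l i0 + b l" if "l \<in> K - {k0}" for l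
      using no k1m[of l] k1m k0 that by (metis Diff_iff insertI1 order_le_less)
    have b0: "b k0 = 0" by (simp add: b_def)
    \<comment> \<open>Comparison with \<open>k0\<close> at \<open>i0\<close> gives
      \<open>b k > - 2 * C\<close>, so there is room to decrease \<open>b k\<close>.\<close>
    have bk': "- (2 * C + 1) < b k" if "k \<in> K - {k0}" for k
      using s0[OF that] C[of k i0] C[OF k0 i0] that i0 b0 by auto
    have step: "\<exists>k\<in>Z. \<exists>i. (i \<in> ?E \<and> (\<forall>l\<in>K. x k i + b k \<le> x l i + b l)) \<and>
        (\<forall>l\<in>Z - {k}. x k i + b k < x l i + b l)" if Z: "Z \<subseteq> K" "Z \<noteq> {}" for Z
    proof (cases "k0 \<in> Z")
      case True
      then show ?thesis using s0 Z i0 by (intro bexI[of _ k0] exI[of _ i0]) (auto intro: less_imp_le)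
    next
      case False
      show ?thesis
      proof (rule ccontr)
        assume c: "\<not> ?thesis"
        \<comment> \<open>All \<open>b k\<close> with \<open>k\<close> in \<open>Z\<close> are
          lowered by the same small \<open>d\<close>. If no member of \<open>Z\<close> had a strict
          peak, the result would stay in \<open>B\<close>, against the minimality of
          \<open>b\<close>.\<close>
        let ?b = "\<lambda>d k. if k \<in> Z then b k - d else b k"
        have right: "\<forall>\<^sub>F d in at_right 0. d < e" if "0 < e" for e :: real
          by (rule eventually_mono[OF eventually_at_right_real[OF that]]) auto
        have fin: "finite Z" using Z K finite_subset by blast
        have "\<forall>\<^sub>F d in at_right 0. \<forall>k\<in>Z. - (2 * C + 1) \<le> b k - d"
        proof (intro eventually_ball_finite fin ballI)
          fix k assume "k \<in> Z"
          then have "0 < b k + (2 * C + 1)" using bk'[of k] Z False by force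
          then have "\<forall>\<^sub>F d in at_right 0. d < b k + (2 * C + 1)" by (rule right)
          then show "\<forall>\<^sub>F d in at_right 0. - (2 * C + 1) \<le> b k - d" by eventually_elim simp
        qed
        moreover have "\<forall>\<^sub>F d in at_right 0. \<forall>k\<in>Z. \<forall>i\<in>?E. \<exists>l\<in>K - {k}. ?b d l + x l i \<le> ?b d k + x k i"
        proof (intro eventually_ball_finite fin fE ballI)
          fix k i assume k: "k \<in> Z" and i: "i \<in> ?E"
          \<comment> \<open>Either something lies strictly below \<open>k\<close> at
            \<open>i\<close>, which a small \<open>d\<close> does not disturb, or another member of
            \<open>Z\<close> is at most \<open>k\<close> there and is lowered along with it.\<close>
          have "(\<exists>l\<in>K. b k + x k i > b l + x l i) \<or> (\<exists>l\<in>Z - {k}. b l + x l i \<le> b k + x k i)"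
          proof (rule ccontr)
            assume n: "\<not> ?thesis"
            then have "\<forall>l\<in>K. x k i + b k \<le> x l i + b l" by (simp add: not_less add.commute)
            moreover have "\<forall>l\<in>Z - {k}. x k i + b k < x l i + b l" using n by (simp add: not_le add.commute)
            ultimately show False using c k i by blast
          qed
          then show "\<forall>\<^sub>F d in at_right 0. \<exists>l\<in>K - {k}. ?b d l + x l i \<le> ?b d k + x k i"
          proof
            assume "\<exists>l\<in>K. b k + x k i > b l + x l i"
            then obtain l where l: "l \<in> K" "b k + x k i > b l + x l i" by blast
            then have "0 < b k + x k i - (b l + x l i)" by simp
            then have "\<forall>\<^sub>F d in at_right 0. d < b k + x k i - (b l + x l i) \<and> d > 0"
              by (intro eventually_conj right eventually_at_right_less)
            then show ?thesis
            proof eventually_elim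
              case (elim d)
              then show ?case using l k by (intro bexI[of _ l]) auto
            qed
          next
            assume "\<exists>l\<in>Z - {k}. b l + x l i \<le> b k + x k i"
            then obtain l where "l \<in> Z - {k}" "b l + x l i \<le> b k + x k i" by blast
            then show ?thesis using k Z by (intro always_eventually allI bexI[of _ l]) auto
          qed
        qed
        moreover have "\<forall>\<^sub>F d in at_right (0::real). d > 0" by (rule eventually_at_right_less)
        ultimately have "\<forall>\<^sub>F d in at_right 0. d > 0 \<and> ?b d \<in> B"
        proof eventually_elim
          case (elim d)
          have "\<exists>l\<in>K - {k}. ?b d l + x l i \<le> ?b d k + x k i" if k: "k \<in> K - {k0}" and i: "i \<in> ?E" for k i
          proof (cases "k \<in> Z")
            case True
            then show ?thesis using elim(2) i by blast
          next
            case kZ: False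
            obtain l where "l \<in> K - {k}" "b l + x l i \<le> b k + x k i" using bc[OF k i] by blast
            then show ?thesis using kZ elim(3) by (intro bexI[of _ l]) auto
          qed
          then show ?case using elim bk False b0 unfolding B_def by auto
        qed
        then obtain d where d: "d > 0" "?b d \<in> B" using eventually_happens[of _ "at_right (0::real)"] by auto
        obtain k where "k \<in> Z" using Z by blast
        then show False using low[OF _ d(2), of k] Z d(1) by auto
      qed
    qed
    obtain c where c1: "\<And>k. k \<in> K \<Longrightarrow> c k \<in> ?E \<and> (\<forall>l\<in>K. x k (c k) + b k \<le> x l (c k) + b l)"
      and c2: "\<And>Z. Z \<subseteq> K \<Longrightarrow> Z \<noteq> {} \<Longrightarrow> \<exists>z\<in>Z. \<forall>k\<in>Z - {z}. x k (c k) + b k < x z (c k) + b z"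
      by (rule triangular_choice[OF K(1), of
            "\<lambda>k i. i \<in> ?E \<and> (\<forall>l\<in>K. x k i + b k \<le> x l i + b l)"
            "\<lambda>k i l. x k i + b k < x l i + b l", OF step]) blast+
    \<comment> \<open>The peaks of all of \<open>K\<close> would form an independent set larger than
      the rank.\<close>
    have "indep M (c ` K) \<and> inj_on c K"
    proof (rule indep_of_peaks[OF m K(1)])
      show "(\<lambda>i. x k i + b k) \<in> bergman M" if "k \<in> K" for k using bergman_add[OF x[OF that]] .
    qed (use c1 c2 in blast)+
    then have "indep M (c ` K)" "card (c ` K) = card K" by (auto simp: card_image)
    then show False using card_le_mrank[OF m indep_ground[OF m]] K(2) by force
  qed
qed

section \<open>Piecewise linear functions on an interval\<close>

text \<open>The subdivision of \<open>PL\<close> on an arbitrary interval, so that pieces can be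
  glued. The bounds on \<open>b i\<close> keep the breakpoints where \<open>trop_ratio\<close> is
  given by its formula.\<close>

definition subdivided_linear :: "(real \<Rightarrow> real) \<Rightarrow> real \<Rightarrow> real \<Rightarrow> bool" where
  "subdivided_linear g u v \<longleftrightarrow> (\<exists>(n::nat) b. b 0 = u \<and> b n = v \<and> (\<forall>i\<le>n. u \<le> b i \<and> b i \<le> v) \<and>
     (\<forall>i<n. b i < b (Suc i) \<and> (\<exists>s::int. \<forall>t\<in>{b i..b (Suc i)}. g t = g (b i) + of_int s * (t - b i))))"

lemma subdivided_linear_single:
  assumes "u < v" "\<And>t. t \<in> {u..v} \<Longrightarrow> g t = g u + of_int s * (t - u)"
  shows "subdivided_linear g u v"
  unfolding subdivided_linear_def
proof (intro exI[of _ "1::nat"] exI[of _ "\<lambda>i. if i = 0 then u else v"] conjI)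
  have "\<exists>s::int. \<forall>t\<in>{u..v}. g t = g u + of_int s * (t - u)" using assms(2) by blast
  then show "\<forall>i<1. (if i = 0 then u else v) < (if Suc i = 0 then u else v) \<and>
      (\<exists>s::int. \<forall>t\<in>{if i = 0 then u else v..if Suc i = 0 then u else v}.
         g t = g (if i = 0 then u else v) + of_int s * (t - (if i = 0 then u else v)))"
    using assms(1) by simp
qed (use assms(1) in auto)

lemma subdivided_linear_trans:
  assumes "subdivided_linear g u v" "subdivided_linear g v w" "u \<le> v" "v \<le> w"
  shows "subdivided_linear g u w"
proof -
  obtain n b where b: "b 0 = u" "b n = v" "\<forall>i\<le>n. u \<le> b i \<and> b i \<le> v"
     "\<forall>i<n. b i < b (Suc i) \<and> (\<exists>s::int. \<forall>t\<in>{b i..b (Suc i)}. g t = g (b i) + of_int s * (t - b i))"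
    using assms(1) unfolding subdivided_linear_def by blast
  obtain m c where c: "c 0 = v" "c m = w" "\<forall>i\<le>m. v \<le> c i \<and> c i \<le> w"
     "\<forall>i<m. c i < c (Suc i) \<and> (\<exists>s::int. \<forall>t\<in>{c i..c (Suc i)}. g t = g (c i) + of_int s * (t - c i))"
    using assms(2) unfolding subdivided_linear_def by blast
  define d where "d i = (if i < n then b i else c (i - n))" for i
  have d1: "d i = b i" if "i \<le> n" for i using that b c by (cases "i = n") (auto simp: d_def)
  have d2: "d i = c (i - n)" if "i \<ge> n" for i using that by (auto simp: d_def)
  have "d i < d (Suc i) \<and> (\<exists>s::int. \<forall>t\<in>{d i..d (Suc i)}. g t = g (d i) + of_int s * (t - d i))" if "i < n + m" for i
  proof (cases "i < n")
    case True
    then show ?thesis using b(4) d1[of i] d1[of "Suc i"] by simp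
  next
    case False
    then show ?thesis using c(4)[rule_format, of "i - n"] d2[of i] d2[of "Suc i"] that by (simp add: Suc_diff_le)
  qed
  moreover have "u \<le> d i \<and> d i \<le> w" if "i \<le> n + m" for i
  proof (cases "i \<le> n")
    case True
    then show ?thesis using b(3) d1[of i] assms by force
  next
    case False
    then have "v \<le> c (i - n) \<and> c (i - n) \<le> w" using c(3) that by simp
    then show ?thesis using d2[of i] False assms by simp
  qed
  ultimately show ?thesis
    unfolding subdivided_linear_def
    by (intro exI[of _ "n + m"] exI[of _ d]) (use d1[of 0] d2[of "n + m"] b c in auto)
qed

text \<open>Compactness: one-sided germs of integer slope give a subdivision near each point, and
  Bolzano's bisection principle glues these.\<close>

lemma subdivided_linear_of_germs:
  fixes g :: "real \<Rightarrow> real"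
  assumes right: "\<And>t. \<exists>s::int. \<exists>\<epsilon>>0. \<forall>h\<in>{0..\<epsilon>}. g (t + h) = g t + of_int s * h"
    and left: "\<And>t. \<exists>s::int. \<exists>\<epsilon>>0. \<forall>h\<in>{0..\<epsilon>}. g (t - h) = g t + of_int s * h"
    and "u < v"
  shows "subdivided_linear g u v"
proof -
  \<comment> \<open>The implication disposes of the degenerate intervals that the principle also
    visits.\<close>
  have "u < v \<longrightarrow> subdivided_linear g u v"
    using less_imp_le[OF \<open>u < v\<close>]
  proof (induction rule: Bolzano)
    case (trans a b c)
    then show ?case using subdivided_linear_trans[of g a b c] by (cases "a = b"; cases "b = c") auto
  next
    case (local x)
    obtain s \<epsilon> where r: "\<epsilon> > 0" "\<forall>h\<in>{0..\<epsilon>}. g (x + h) = g x + of_int s * h" using right by blast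
    obtain s' \<epsilon>' where l: "\<epsilon>' > 0" "\<forall>h\<in>{0..\<epsilon>'}. g (x - h) = g x + of_int s' * h" using left by blast
    have "subdivided_linear g a b" if ab: "a \<le> x" "x \<le> b" "b - a < min \<epsilon> \<epsilon>'" "a < b" for a b
    proof -
      have R: "subdivided_linear g x b" if "x < b"
      proof (rule subdivided_linear_single[OF that])
        fix t assume "t \<in> {x..b}"
        then show "g t = g x + of_int s * (t - x)" using r(2)[rule_format, of "t - x"] ab by auto
      qed
      have L: "subdivided_linear g a x" if "a < x"
      proof (rule subdivided_linear_single[OF that])
        fix t assume "t \<in> {a..x}"
        then have "g t = g x + of_int s' * (x - t)" "g a = g x + of_int s' * (x - a)"
          using l(2)[rule_format, of "x - t"] l(2)[rule_format, of "x - a"] ab by auto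
        then show "g t = g a + of_int (- s') * (t - a)" by (simp add: algebra_simps)
      qed
      show ?thesis using L R ab subdivided_linear_trans[of g a x b] by (cases "a = x"; cases "x = b") auto
    qed
    then show ?case using r l by (intro exI[of _ "min \<epsilon> \<epsilon>'"]) auto
  qed
  then show ?thesis using \<open>u < v\<close> by blast
qed

text \<open>For small \<open>h > 0\<close> a term starting strictly above the least value stays
  above by continuity, and among those starting at the least value the smallest slope wins.\<close>

lemma Min_affine_germ:
  fixes c s :: "'i \<Rightarrow> real"
  assumes I: "finite I" "k \<in> I" and min: "\<And>i. i \<in> I \<Longrightarrow> c k \<le> c i"
    and slope: "\<And>i. i \<in> I \<Longrightarrow> c i = c k \<Longrightarrow> s k \<le> s i"
  shows "\<exists>\<epsilon>>0. \<forall>h\<in>{0..\<epsilon>}. Min ((\<lambda>i. c i + s i * h) ` I) = c k + s k * h"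
proof -
  have "\<forall>\<^sub>F h in at_right 0. \<forall>i\<in>I. c k + s k * h \<le> c i + s i * h"
  proof (intro eventually_ball_finite I ballI)
    fix i assume i: "i \<in> I"
    show "\<forall>\<^sub>F h in at_right 0. c k + s k * h \<le> c i + s i * h"
    proof (cases "c i = c k")
      case True
      have "\<forall>\<^sub>F h in at_right (0::real). 0 < h" by (rule eventually_at_right_less)
      then show ?thesis
        by (rule eventually_mono) (use slope[OF i True] True in \<open>simp add: mult_right_mono\<close>)
    next
      case False
      then have "c k < c i" using min[OF i] by simp
      moreover have "((\<lambda>h. c i + s i * h - (c k + s k * h)) \<longlongrightarrow> c i + s i * 0 - (c k + s k * 0)) (at_right 0)"
        by (intro tendsto_intros)
      ultimately have "\<forall>\<^sub>F h in at_right 0. 0 < c i + s i * h - (c k + s k * h)"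
        by (intro order_tendstoD(1)) auto
      then show ?thesis by eventually_elim simp
    qed
  qed
  then obtain b where b: "b > 0" "\<And>h. h > 0 \<Longrightarrow> h < b \<Longrightarrow> \<forall>i\<in>I. c k + s k * h \<le> c i + s i * h"
    unfolding eventually_at_right_field by blast
  have "Min ((\<lambda>i. c i + s i * h) ` I) = c k + s k * h" if "h \<in> {0..b / 2}" for h
  proof (rule Min_eqI)
    show "c k + s k * h \<le> y" if "y \<in> (\<lambda>i. c i + s i * h) ` I" for y
      using that \<open>h \<in> {0..b / 2}\<close> b(1) b(2)[of h] min by (cases "h = 0") auto
  qed (use I in auto)
  then show ?thesis using b(1) by (intro exI[of _ "b / 2"]) auto
qed

section \<open>Tropical polynomials\<close>

text \<open>The lines \<open>i - 1\<close> and \<open>i\<close> cross at \<open>t = i\<close>.\<close>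
definition line :: "nat \<Rightarrow> nat \<Rightarrow> real \<Rightarrow> real" where
  "line n i t = real n * (real i * (real i + 1) / 2 - real i * t)"

definition trop :: "nat \<Rightarrow> (nat \<Rightarrow> real) \<Rightarrow> real \<Rightarrow> real" where
  "trop n x t = Min ((\<lambda>i. x i + line n i t) ` {..<n})"

definition minimizers :: "nat \<Rightarrow> (nat \<Rightarrow> real) \<Rightarrow> real \<Rightarrow> nat set" where
  "minimizers n x t = {i. i < n \<and> x i + line n i t = trop n x t}"

text \<open>The exponents minimal just to the right and just to the left of \<open>t\<close>; beyond the ends of
  \<open>{0..n}\<close> the zero polynomial has the exponents \<open>n - 1\<close> and \<open>0\<close>.\<close>
definition hi :: "nat \<Rightarrow> (nat \<Rightarrow> real) \<Rightarrow> real \<Rightarrow> nat" where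
  "hi n x t = (if real n \<le> t then n - 1 else Max (minimizers n x t))"

definition lo :: "nat \<Rightarrow> (nat \<Rightarrow> real) \<Rightarrow> real \<Rightarrow> nat" where
  "lo n x t = (if t \<le> 0 then 0 else Min (minimizers n x t))"

text \<open>The multiplicity of the zero at \<open>t\<close>, that is, the drop of the slope there;
  the slopes are multiples of \<open>n\<close>.\<close>

definition chips :: "nat \<Rightarrow> (nat \<Rightarrow> real) \<Rightarrow> real \<Rightarrow> int" where
  "chips n x t = int n * (int (hi n x t) - int (lo n x t))"

lemma trop_le: "i < n \<Longrightarrow> trop n x t \<le> x i + line n i t"
  unfolding trop_def by (rule Min_le) auto

lemma trop_ge: "0 < n \<Longrightarrow> (\<And>i. i < n \<Longrightarrow> c \<le> x i + line n i t) \<Longrightarrow> c \<le> trop n x t"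
  unfolding trop_def by (subst Min_ge_iff) auto

lemma finite_minimizers: "finite (minimizers n x t)"
  by (simp add: minimizers_def)

lemma minimizers_nonempty: "0 < n \<Longrightarrow> minimizers n x t \<noteq> {}"
proof -
  assume "0 < n"
  then have "trop n x t \<in> (\<lambda>i. x i + line n i t) ` {..<n}" unfolding trop_def by (intro Min_in) auto
  then show ?thesis by (auto simp: minimizers_def)
qed

lemma line_add: "line n i (t + h) = line n i t - real n * real i * h"
  by (simp add: line_def algebra_simps)

lemma line_diff: "line n i (t - h) = line n i t + real n * real i * h"
  by (simp add: line_def algebra_simps)

text \<open>The \<open>i\<close>-th term has slope \<open>- n * i\<close>, so the largest minimizing
  exponent prevails to the right of \<open>t\<close>, and in \<open>trop_left\<close> the
  smallest.\<close>

lemma trop_right: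
  assumes "0 < n"
  shows "\<exists>\<epsilon>>0. \<forall>h\<in>{0..\<epsilon>}. trop n x (t + h) = trop n x t - real n * real (Max (minimizers n x t)) * h"
proof -
  let ?k = "Max (minimizers n x t)"
  have k: "?k \<in> minimizers n x t" using assms by (simp add: finite_minimizers minimizers_nonempty)
  have "\<exists>\<epsilon>>0. \<forall>h\<in>{0..\<epsilon>}. Min ((\<lambda>i. (x i + line n i t) + (- (real n * real i)) * h) ` {..<n})
      = (x ?k + line n ?k t) + (- (real n * real ?k)) * h"
  proof (rule Min_affine_germ)
    fix i assume "i \<in> {..<n}"
    then show "x ?k + line n ?k t \<le> x i + line n i t" using k trop_le[of i n x t] by (simp add: minimizers_def)
    assume "x i + line n i t = x ?k + line n ?k t"
    then have "i \<in> minimizers n x t" using k \<open>i \<in> _\<close> by (simp add: minimizers_def)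
    then have "i \<le> ?k" by (simp add: finite_minimizers)
    then show "- (real n * real ?k) \<le> - (real n * real i)" by (simp add: mult_left_mono)
  qed (use k in \<open>auto simp: minimizers_def\<close>)
  moreover have "x ?k + line n ?k t = trop n x t" using k by (simp add: minimizers_def)
  ultimately show ?thesis by (simp add: trop_def line_add add_diff_eq)
qed

lemma trop_left:
  assumes "0 < n"
  shows "\<exists>\<epsilon>>0. \<forall>h\<in>{0..\<epsilon>}. trop n x (t - h) = trop n x t + real n * real (Min (minimizers n x t)) * h"
proof -
  let ?k = "Min (minimizers n x t)"
  have k: "?k \<in> minimizers n x t" using assms by (simp add: finite_minimizers minimizers_nonempty)
  have "\<exists>\<epsilon>>0. \<forall>h\<in>{0..\<epsilon>}. Min ((\<lambda>i. (x i + line n i t) + real n * real i * h) ` {..<n})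
      = (x ?k + line n ?k t) + real n * real ?k * h"
  proof (rule Min_affine_germ)
    fix i assume "i \<in> {..<n}"
    then show "x ?k + line n ?k t \<le> x i + line n i t" using k trop_le[of i n x t] by (simp add: minimizers_def)
    assume "x i + line n i t = x ?k + line n ?k t"
    then have "i \<in> minimizers n x t" using k \<open>i \<in> _\<close> by (simp add: minimizers_def)
    then have "?k \<le> i" by (simp add: finite_minimizers)
    then show "real n * real ?k \<le> real n * real i" by (simp add: mult_left_mono)
  qed (use k in \<open>auto simp: minimizers_def\<close>)
  moreover have "x ?k + line n ?k t = trop n x t" using k by (simp add: minimizers_def)
  ultimately show ?thesis by (simp add: trop_def line_diff add.assoc)
qed

text \<open>Concavity of \<open>trop\<close>, obtained by adding the two minimality
  inequalities.\<close>

lemma minimizers_mono: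
  assumes "i \<in> minimizers n x t" "j \<in> minimizers n x u" "t < u"
  shows "i \<le> j"
proof (rule ccontr)
  assume "\<not> i \<le> j"
  then have n: "0 < n" and lt: "real j < real i" using assms by (auto simp: minimizers_def)
  have "x i + line n i t \<le> x j + line n j t" "x j + line n j u \<le> x i + line n i u"
    using assms trop_le[of j n x t] trop_le[of i n x u] by (auto simp: minimizers_def)
  then have "line n i t - line n i u \<le> line n j t - line n j u" by simp
  moreover have "line n i t - line n i u = real n * (u - t) * real i" for i
    by (simp add: line_def algebra_simps)
  ultimately have "real n * (u - t) * real i \<le> real n * (u - t) * real j" by simp
  then show False using n lt assms(3) by (simp add: mult_le_cancel_left)
qed

lemma hi_less: "0 < n \<Longrightarrow> hi n x t < n"
  using Max_in[OF finite_minimizers minimizers_nonempty, of n x t] by (auto simp: hi_def minimizers_def)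

lemma minimizers_le_hi: "i \<in> minimizers n x t \<Longrightarrow> i \<le> hi n x t"
  by (auto simp: hi_def finite_minimizers) (auto simp: minimizers_def)

lemma lo_le_minimizers: "i \<in> minimizers n x t \<Longrightarrow> lo n x t \<le> i"
  by (auto simp: lo_def finite_minimizers)

lemma lo_le_hi: "0 < n \<Longrightarrow> lo n x t \<le> hi n x t"
  using minimizers_nonempty[of n x t] minimizers_le_hi lo_le_minimizers by (meson ex_in_conv le_trans)

lemma chips_nonneg: "0 < n \<Longrightarrow> 0 \<le> chips n x t"
  using lo_le_hi[of n x t] by (simp add: chips_def)

lemma hi_le_lo:
  assumes "0 < n" "t < u" "0 \<le> t" "u \<le> real n"
  shows "hi n x t \<le> lo n x u"
  using assms minimizers_mono[OF Max_in Min_in, OF finite_minimizers minimizers_nonempty finite_minimizers minimizers_nonempty]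
  by (auto simp: hi_def lo_def)

lemma chips_tie:
  assumes "i \<in> minimizers n x t" "j \<in> minimizers n x t" "i \<noteq> j"
  shows "chips n x t \<ge> int n"
proof -
  have "lo n x t < hi n x t"
    using assms minimizers_le_hi[of i n x t] minimizers_le_hi[of j n x t] lo_le_minimizers[of i n x t] lo_le_minimizers[of j n x t]
    by linarith
  then have "int n * 1 \<le> chips n x t" unfolding chips_def by (intro mult_left_mono) auto
  then show ?thesis by simp
qed

text \<open>Every zero raises the exponent, so \<open>hi\<close> is injective on the zeros, with
  values in \<open>{1..n - 1}\<close>.\<close>

lemma card_chips_le:
  assumes "0 < n"
  shows "finite {t \<in> {0..real n}. chips n x t \<noteq> 0} \<and> card {t \<in> {0..real n}. chips n x t \<noteq> 0} \<le> n - 1"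
proof -
  let ?S = "{t \<in> {0..real n}. chips n x t \<noteq> 0}"
  have lt: "lo n x t < hi n x t" if "t \<in> ?S" for t
    using that lo_le_hi[OF assms, of x t] by (auto simp: chips_def)
  have "inj_on (hi n x) ?S"
  proof (rule linorder_inj_onI)
    fix t u assume "t < u" "t \<in> ?S" "u \<in> ?S"
    then show "hi n x t \<noteq> hi n x u" using hi_le_lo[OF assms, of t u x] lt[of u] by auto
  qed auto
  moreover have "hi n x ` ?S \<subseteq> {1..n - 1}"
  proof (rule image_subsetI)
    fix t assume "t \<in> ?S"
    then show "hi n x t \<in> {1..n - 1}" using lt[of t] hi_less[OF assms, of x t] by simp
  qed
  ultimately show ?thesis
    using inj_on_finite[of "hi n x" ?S "{1..n - 1}"] card_inj_on_le[of "hi n x" ?S "{1..n - 1}"] by simp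
qed

text \<open>The locus where the zero polynomial is given by its \<open>i\<close>-th term alone.\<close>
definition region :: "nat \<Rightarrow> nat \<Rightarrow> real set" where
  "region n i = {t. (i = 0 \<or> real i < t) \<and> (Suc i = n \<or> t < real i + 1)}"

text \<open>The lines \<open>i\<close> and \<open>j\<close> cross at \<open>(i + j + 1) / 2\<close>,
  which is outside region \<open>i\<close>, on the side of \<open>j\<close>.\<close>

lemma line_less:
  assumes "i < n" "j < n" "j \<noteq> i" "t \<in> region n i"
  shows "line n i t < line n j t"
proof -
  have eq: "line n j t - line n i t = real n * ((real j - real i) * ((real j + real i + 1) / 2 - t))"
    by (simp add: line_def field_simps)
  have "0 < (real j - real i) * ((real j + real i + 1) / 2 - t)"
  proof (cases "i < j")
    case True
    then have "real i + 1 \<le> real j" by linarith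
    moreover have "t < real i + 1" using assms True by (auto simp: region_def)
    ultimately show ?thesis by (intro mult_pos_pos) auto
  next
    case False
    then have "real j + 1 \<le> real i" using assms by linarith
    moreover have "real i < t" using assms False by (auto simp: region_def)
    ultimately show ?thesis by (intro mult_neg_neg) auto
  qed
  then have "0 < line n j t - line n i t" unfolding eq
    by (rule mult_pos_pos[rotated]) (use assms(1) in simp)
  then show ?thesis by simp
qed

lemma trop_zero_region: "i < n \<Longrightarrow> t \<in> region n i \<Longrightarrow> trop n (\<lambda>_. 0) t = line n i t"
  using trop_le[of i n "\<lambda>_. 0" t] trop_ge[of n "line n i t" "\<lambda>_. 0" t] line_less[of i n _ t]
  by (metis add_0 antisym gr_zeroI less_imp_le not_less_zero order_refl)

lemma minimizers_zero_region:
  assumes "i < n" "t \<in> region n i"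
  shows "minimizers n (\<lambda>_. 0) t = {i}"
proof -
  have "j = i" if "j < n" "line n j t = line n i t" for j
    using line_less[OF assms(1) that(1) _ assms(2)] that(2) by force
  then show ?thesis using assms(1) trop_zero_region[OF assms] by (auto simp: minimizers_def)
qed

lemma chips_zero_region:
  assumes "i < n" "t \<in> region n i" "0 \<le> t" "t \<le> real n"
  shows "chips n (\<lambda>_. 0) t = 0"
  using assms by (auto simp: chips_def hi_def lo_def minimizers_zero_region region_def)

lemma chips_zero_break:
  assumes "0 < k" "k < n"
  shows "chips n (\<lambda>_. 0) (real k) = int n"
proof -
  \<comment> \<open>Up to a positive factor the difference is a product of consecutive integers:
    never negative, and zero exactly for \<open>j = k\<close> and \<open>j = k - 1\<close>.\<close>
  have eq: "line n j (real k) - line n k (real k) = real n * ((real j - real k) * (real j + 1 - real k)) / 2" for j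
    by (simp add: line_def field_simps)
  have nn: "0 \<le> (real j - real k) * (real j + 1 - real k)" for j
  proof (cases "k \<le> j")
    case False
    then have "real j + 1 \<le> real k" by linarith
    then show ?thesis by (intro mult_nonpos_nonpos) auto
  qed auto
  have le: "line n k (real k) \<le> line n j (real k)" for j
    using eq[of j] nn[of j] by (smt (verit) divide_nonneg_nonneg mult_nonneg_nonneg of_nat_0_le_iff)
  have tr: "trop n (\<lambda>_. 0) (real k) = line n k (real k)"
    using assms le by (intro antisym trop_ge) (auto intro!: order_trans[OF trop_le])
  have "line n j (real k) = line n k (real k) \<longleftrightarrow> j = k \<or> Suc j = k" for j
    using eq[of j] assms by auto
  then have "minimizers n (\<lambda>_. 0) (real k) = {j. j < n \<and> (j = k \<or> Suc j = k)}"
    by (simp add: minimizers_def tr)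
  also have "\<dots> = {k, k - 1}" using assms by auto
  finally show ?thesis using assms by (auto simp: chips_def hi_def lo_def of_nat_diff)
qed

lemma region_cases:
  assumes "0 < n" "0 \<le> t" "t \<le> real n"
  obtains (region) i where "i < n" "t \<in> region n i" | (break) k where "0 < k" "k < n" "t = real k"
proof (cases "t = real n")
  case True
  then have "t \<in> region n (n - 1)" using assms by (auto simp: region_def of_nat_diff)
  then show ?thesis using region[of "n - 1"] assms by simp
next
  case False
  define k where "k = nat \<lfloor>t\<rfloor>"
  have k: "real k \<le> t" "t < real k + 1" using assms by (auto simp: k_def) 
  then have kn: "k < n" using assms False by linarith
  \<comment> \<open>The integer \<open>0\<close> is no breakpoint: it belongs to region
    \<open>0\<close>.\<close>
  show ?thesis
  proof (cases "t = real k \<and> 0 < k")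
    case True
    then show ?thesis using break kn by blast
  next
    case False
    then show ?thesis using region[of k] kn k by (force simp: region_def)
  qed
qed

lemma region_disjoint:
  assumes "i < n" "j < n" "t \<in> region n i" "t \<in> region n j"
  shows "i = j"
  using assms line_less[of i n j t] line_less[of j n i t] by fastforce

lemma mid_region: "real i + 1 / 2 \<in> region n i"
  by (simp add: region_def)

section \<open>General facts on metric graphs\<close>

lemma topspace_quotient_topology: "topspace (quotient_topology X f) = f ` topspace X"
proof -
  have "openin (quotient_topology X f) (f ` topspace X)"
    unfolding openin_quotient_topology by (metis (mono_tags, lifting) Collect_cong image_eqI mem_Collect_eq openin_topspace order_refl Collect_mem_eq)
  then show ?thesis
    using openin_subset openin_quotient_topology[of X f "topspace (quotient_topology X f)"] by blast
qed

lemma topspace_gtop: "metric_graph \<Gamma> \<Longrightarrow> topspace (gtop \<Gamma>) = points \<Gamma>"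
  by (simp add: gtop_def Metric_space.topspace_mtopology Metric_space_gdist)

text \<open>The chips, listed with multiplicity by way of a multiset, are a tuple over
  \<open>D\<close>. Without this \<open>D\<close> would have no neighbourhood in
  \<open>linear_system_top\<close>.\<close>

lemma divisor_in_Sym:
  assumes g: "metric_graph \<Gamma>" and D: "is_divisor \<Gamma> D" "effective D"
  shows "D \<in> topspace (Sym \<Gamma> (nat (deg D)))"
proof -
  define m where "m = Abs_multiset (\<lambda>p. nat (D p))"
  have "0 < nat (D p) \<longleftrightarrow> D p \<noteq> 0" for p
    using D(2)[unfolded effective_def, rule_format, of p] by linarith
  then have s: "{p. 0 < nat (D p)} = supp D" by (simp add: supp_def)
  have fin: "finite (supp D)" using D(1) by (simp add: is_divisor_def)
  have cm: "count m = (\<lambda>p. nat (D p))" unfolding m_def by (rule Abs_multiset_inverse) (simp only: s mem_Collect_eq fin)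
  obtain xs where xs: "mset xs = m" using ex_mset by blast
  have sm: "set_mset m = supp D" by (simp only: set_mset_def cm s)
  have "int (size m) = (\<Sum>p\<in>supp D. int (nat (D p)))" by (simp add: size_multiset_overloaded_eq sm cm)
  also have "\<dots> = deg D"
    unfolding deg_def using D(2) by (intro sum.cong) (auto simp: effective_def)
  finally have len: "length xs = nat (deg D)" using xs by (metis nat_int size_mset)
  define x where "x = (\<lambda>i\<in>{..<nat (deg D)}. xs ! i)"
  have "x \<in> (\<Pi>\<^sub>E i\<in>{..<nat (deg D)}. points \<Gamma>)"
  proof -
    have "set xs \<subseteq> points \<Gamma>" using D(1) sm xs by (metis is_divisor_def set_mset_mset)
    then show ?thesis unfolding x_def using len by (auto simp: subset_iff)
  qed
  moreover have "tuple_divisor (nat (deg D)) x = D"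
  proof
    fix p
    have "{i. i < nat (deg D) \<and> x i = p} = {i. i < length xs \<and> xs ! i = p}" using len by (auto simp: x_def)
    then have "tuple_divisor (nat (deg D)) x p = int (count (mset xs) p)"
      by (simp add: tuple_divisor_def count_mset count_list_eq_length_filter length_filter_conv_card eq_commute)
    then show "tuple_divisor (nat (deg D)) x p = D p" using D(2) by (simp add: xs cm effective_def)
  qed
  ultimately show ?thesis
    unfolding Sym_def topspace_quotient_topology topspace_product_topology
    by (intro image_eqI[of _ _ x]) (auto simp: topspace_gtop[OF g])
qed

text \<open>A component contains each piece it meets, as pieces are connected, and meets no second
  one, as the piece and the union of the others would separate it.\<close>

lemma connected_components_of_open_partition:
  assumes op: "\<And>i. i \<in> I \<Longrightarrow> openin X (R i)" and con: "\<And>i. i \<in> I \<Longrightarrow> connectedin X (R i)"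
    and ne: "\<And>i. i \<in> I \<Longrightarrow> R i \<noteq> {}" and dis: "disjoint_family_on R I" and un: "(\<Union>i\<in>I. R i) = topspace X"
  shows "connected_components_of X = R ` I"
proof -
  have eq: "C = R i" if C: "C \<in> connected_components_of X" and i: "i \<in> I" and CR: "C \<inter> R i \<noteq> {}" for C i
  proof (rule antisym)
    show "R i \<subseteq> C" using connected_components_of_maximal[OF C con[OF i]] CR by (simp add: disjnt_def)
    show "C \<subseteq> R i"
    proof (rule ccontr)
      assume n: "\<not> C \<subseteq> R i"
      have Ct: "C \<subseteq> topspace X" using connected_components_of_subset[OF C] .
      have opU: "openin X (\<Union>j\<in>I - {i}. R j)" using op by blast
      have "C \<subseteq> R i \<union> (\<Union>j\<in>I - {i}. R j)" using Ct un by blast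
      moreover have "R i \<inter> (\<Union>j\<in>I - {i}. R j) \<inter> C = {}" using dis i by (fastforce simp: disjoint_family_on_def)
      moreover have "R i \<inter> C \<noteq> {}" "(\<Union>j\<in>I - {i}. R j) \<inter> C \<noteq> {}" using CR n Ct un by blast+
      ultimately show False
        using connectedinD[OF connectedin_connected_components_of[OF C] op[OF i] opU] by blast
    qed
  qed
  show ?thesis
  proof (intro equalityI subsetI)
    fix C assume C: "C \<in> connected_components_of X"
    then obtain y where "y \<in> C" using nonempty_connected_components_of by blast
    then obtain i where "i \<in> I" "y \<in> R i" using un connected_components_of_subset[OF C] by blast
    then show "C \<in> R ` I" using eq[OF C] \<open>y \<in> C\<close> by blast
  next
    fix Z assume "Z \<in> R ` I"
    then obtain i y where i: "i \<in> I" "Z = R i" "y \<in> R i" using ne by blast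
    then have "y \<in> \<Union> (connected_components_of X)" using un by (auto simp: Union_connected_components_of)
    then obtain C where "C \<in> connected_components_of X" "y \<in> C" by blast
    then show "Z \<in> connected_components_of X" using eq i by blast
  qed
qed

lemma tropical_span_indexed:
  assumes C: "finite C" "C \<noteq> {}" and g: "\<And>c. c \<in> C \<Longrightarrow> g c \<in> G"
  shows "(\<lambda>p\<in>points \<Gamma>. Min ((\<lambda>c. g c p + a c) ` C)) \<in> tropical_span \<Gamma> G"
proof -
  \<comment> \<open>Different indices may name the same generator, while
    \<open>tropical_span\<close> allows one coefficient for each; the smallest is kept.\<close>
  define b where "b \<psi> = Min (a ` {c \<in> C. g c = \<psi>})" for \<psi>
  have "Min ((\<lambda>\<psi>. \<psi> p + b \<psi>) ` g ` C) = Min ((\<lambda>c. g c p + a c) ` C)" for p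
  proof (rule Min_eqI)
    show ge: "Min ((\<lambda>c. g c p + a c) ` C) \<le> y" if y: "y \<in> (\<lambda>\<psi>. \<psi> p + b \<psi>) ` g ` C" for y
    proof -
      obtain c where c: "c \<in> C" "y = g c p + b (g c)" using y by blast
      have "b (g c) \<in> a ` {d \<in> C. g d = g c}" unfolding b_def using C c by (intro Min_in) auto
      then obtain d where "d \<in> C" "g d = g c" "b (g c) = a d" by auto
      then show ?thesis using C c by (metis (no_types, lifting) Min_le finite_imageI imageI)
    qed
    have "Min ((\<lambda>c. g c p + a c) ` C) \<in> (\<lambda>c. g c p + a c) ` C" using C by (intro Min_in) auto
    then obtain c where c: "c \<in> C" "Min ((\<lambda>c. g c p + a c) ` C) = g c p + a c" by auto
    have "b (g c) \<le> a c" unfolding b_def using c C by (intro Min_le) auto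
    then have "Min ((\<lambda>c. g c p + a c) ` C) = g c p + b (g c)" using ge[of "g c p + b (g c)"] c by auto
    then show "Min ((\<lambda>c. g c p + a c) ` C) \<in> (\<lambda>\<psi>. \<psi> p + b \<psi>) ` g ` C" using c by blast
  qed (use C in auto)
  then show ?thesis
    unfolding tropical_span_def using C g
    by (intro CollectI exI[of _ "g ` C"] exI[of _ b]) auto
qed

section \<open>The interval as a metric graph\<close>

definition interval_graph :: "nat \<Rightarrow> (nat, nat) metric_graph_data" where
  "interval_graph n = \<lparr>verts = {0, 1}, edges = {0}, tail = (\<lambda>_. 0), head = (\<lambda>_. 1), len = (\<lambda>_. real n)\<rparr>"

definition pos :: "nat \<Rightarrow> (nat, nat) point \<Rightarrow> real" where
  "pos n p = (case p of Vertex v \<Rightarrow> if v = 0 then 0 else real n | Interior e t \<Rightarrow> t)"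

abbreviation at_pos :: "nat \<Rightarrow> real \<Rightarrow> (nat, nat) point" where
  "at_pos n t \<equiv> edge_pt (interval_graph n) 0 t"

lemma interval_graph_simps [simp]:
  "verts (interval_graph n) = {0, 1}" "edges (interval_graph n) = {0}" "tail (interval_graph n) e = 0"
  "head (interval_graph n) e = 1" "len (interval_graph n) e = real n"
  by (simp_all add: interval_graph_def)

definition trop_ratio :: "nat \<Rightarrow> (nat \<Rightarrow> real) \<Rightarrow> (nat, nat) point \<Rightarrow> real" where
  "trop_ratio n x = (\<lambda>p\<in>points (interval_graph n). trop n x (pos n p) - trop n (\<lambda>_. 0) (pos n p))"

definition base_divisor :: "nat \<Rightarrow> (nat, nat) point \<Rightarrow> int" where
  "base_divisor n p = (if p \<in> points (interval_graph n) then chips n (\<lambda>_. 0) (pos n p) else 0)"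

context
  fixes n :: nat
  assumes n: "0 < n"
begin

lemma metric_graph_interval: "metric_graph (interval_graph n)"
  using n by (auto simp: metric_graph_def)

lemma pos_at_pos: "0 \<le> t \<Longrightarrow> t \<le> real n \<Longrightarrow> pos n (at_pos n t) = t"
  using n by (auto simp: pos_def edge_pt_def)

lemma at_pos_points: "at_pos n t \<in> points (interval_graph n)"
  by (rule edge_pt_in[OF metric_graph_interval]) simp

lemma points_cases:
  assumes "p \<in> points (interval_graph n)"
  obtains t where "0 \<le> t" "t \<le> real n" "p = at_pos n t" "pos n p = t"
proof (rule that[of "pos n p"])
  show "0 \<le> pos n p" "pos n p \<le> real n" "p = at_pos n (pos n p)"
    using assms n by (auto simp: points_def pos_def edge_pt_def)
qed simp

lemma inj_on_at_pos: "inj_on (at_pos n) {0..real n}"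
  by (rule inj_on_inverseI[of _ "pos n"]) (simp add: pos_at_pos)

lemma points_interval: "points (interval_graph n) = at_pos n ` {0..real n}"
  using at_pos_points by (auto elim!: points_cases)

text \<open>The direct move realizes the distance, and no walk is shorter because \<open>pos\<close>
  is 1-Lipschitz along walks.\<close>

lemma gdist_interval:
  assumes s: "s \<in> {0..real n}" and t: "t \<in> {0..real n}"
  shows "gdist (interval_graph n) (at_pos n s) (at_pos n t) = dist s t"
proof -
  have "walk (interval_graph n) (at_pos n s) (at_pos n t) (0 + \<bar>t - s\<bar>)"
    using s t by (intro walk.move walk.stay at_pos_points) auto
  moreover have "\<bar>t - s\<bar> \<le> l" if w: "walk (interval_graph n) (at_pos n s) (at_pos n t) l" for l
  proof -
    have "\<bar>pos n (at_pos n s) - pos n (at_pos n t)\<bar> \<le> 1 * l"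
      by (rule walk_lip[OF _ w]) (simp add: pos_at_pos)
    then show ?thesis using s t by (simp add: pos_at_pos)
  qed
  ultimately have "Inf {l. walk (interval_graph n) (at_pos n s) (at_pos n t) l} = \<bar>t - s\<bar>"
    by (intro cInf_eq_minimum) auto
  then show ?thesis using at_pos_points by (simp add: gdist_def dist_real_def abs_minus_commute)
qed

lemma homeomorphic_interval: "homeomorphic_map (top_of_set {0..real n}) (gtop (interval_graph n)) (at_pos n)"
proof -
  interpret S: Submetric UNIV dist "{0..real n}" by unfold_locales auto
  interpret G: Metric_space "points (interval_graph n)" "gdist (interval_graph n)"
    by (rule Metric_space_gdist[OF metric_graph_interval])
  interpret Metric_space12 "{0..real n}" dist "points (interval_graph n)" "gdist (interval_graph n)" ..
  have "homeomorphic_map S.sub.mtopology G.mtopology (at_pos n)"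
    by (rule isometry_imp_homeomorphic_map) (simp_all add: points_interval gdist_interval)
  then show ?thesis by (simp add: S.mtopology_submetric gtop_def)
qed

lemma tangents_interval:
  assumes "0 \<le> t" "t \<le> real n"
  shows "tangents (interval_graph n) (at_pos n t) =
    (if t < real n then {(0, t, 1)} else {}) \<union> (if 0 < t then {(0, t, - 1)} else {})"
proof -
  have eq: "0 \<le> s \<and> s \<le> real n \<and> at_pos n s = at_pos n t \<longleftrightarrow> s = t" for s
    using assms pos_at_pos by metis
  have "tangents (interval_graph n) (at_pos n t) =
      {(e, s, \<sigma>). e = 0 \<and> (0 \<le> s \<and> s \<le> real n \<and> at_pos n s = at_pos n t) \<and>
        (\<sigma> = 1 \<and> s < real n \<or> \<sigma> = - 1 \<and> 0 < s)}"
    by (auto simp: tangents_def)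
  then show ?thesis unfolding eq by auto
qed

section \<open>Slopes and divisors of the tropical quotients\<close>

lemma trop_ratio_at_pos:
  "0 \<le> t \<Longrightarrow> t \<le> real n \<Longrightarrow> trop_ratio n x (at_pos n t) = trop n x t - trop n (\<lambda>_. 0) t"
  by (simp add: trop_ratio_def at_pos_points pos_at_pos)

lemma germ_right:
  "\<exists>\<epsilon>>0. \<forall>h\<in>{0..\<epsilon>}. trop n x (t + h) - trop n y (t + h) = trop n x t - trop n y t +
     of_int (int n * (int (Max (minimizers n y t)) - int (Max (minimizers n x t)))) * h"
proof -
  obtain \<epsilon> \<delta> where "\<epsilon> > 0" "\<forall>h\<in>{0..\<epsilon>}. trop n x (t + h) = trop n x t - real n * real (Max (minimizers n x t)) * h"
    "\<delta> > 0" "\<forall>h\<in>{0..\<delta>}. trop n y (t + h) = trop n y t - real n * real (Max (minimizers n y t)) * h"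
    using trop_right[OF n] by metis
  then show ?thesis by (intro exI[of _ "min \<epsilon> \<delta>"]) (auto simp: algebra_simps)
qed

lemma germ_left:
  "\<exists>\<epsilon>>0. \<forall>h\<in>{0..\<epsilon>}. trop n x (t - h) - trop n y (t - h) = trop n x t - trop n y t +
     of_int (int n * (int (Min (minimizers n x t)) - int (Min (minimizers n y t)))) * h"
proof -
  obtain \<epsilon> \<delta> where "\<epsilon> > 0" "\<forall>h\<in>{0..\<epsilon>}. trop n x (t - h) = trop n x t + real n * real (Min (minimizers n x t)) * h"
    "\<delta> > 0" "\<forall>h\<in>{0..\<delta>}. trop n y (t - h) = trop n y t + real n * real (Min (minimizers n y t)) * h"
    using trop_left[OF n] by metis
  then show ?thesis by (intro exI[of _ "min \<epsilon> \<delta>"]) (auto simp: algebra_simps)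
qed

lemma trop_ratio_PL: "trop_ratio n x \<in> PL (interval_graph n)"
proof -
  have "subdivided_linear (\<lambda>t. trop n x t - trop n (\<lambda>_. 0) t) 0 (real n)"
    by (rule subdivided_linear_of_germs, rule exI, rule germ_right, rule exI, rule germ_left) (use n in simp)
  then obtain m b where b: "b 0 = 0" "b m = real n" "\<forall>i\<le>m. 0 \<le> b i \<and> b i \<le> real n"
    "\<forall>i<m. b i < b (Suc i) \<and> (\<exists>s::int. \<forall>t\<in>{b i..b (Suc i)}. trop n x t - trop n (\<lambda>_. 0) t
        = trop n x (b i) - trop n (\<lambda>_. 0) (b i) + of_int s * (t - b i))"
    unfolding subdivided_linear_def by blast
  have "b i < b (Suc i) \<and> (\<exists>s::int. \<forall>t\<in>{b i..b (Suc i)}.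
      trop_ratio n x (at_pos n t) = trop_ratio n x (at_pos n (b i)) + of_int s * (t - b i))" if i: "i < m" for i
  proof -
    have "0 \<le> b i" "b i \<le> real n" "b (Suc i) \<le> real n" using b(3) i by auto
    then have "trop_ratio n x (at_pos n t) = trop n x t - trop n (\<lambda>_. 0) t" if "t \<in> {b i..b (Suc i)}" for t
      using that by (intro trop_ratio_at_pos) auto
    then show ?thesis using b(4) i by simp
  qed
  then have "\<exists>(m::nat) b. b 0 = 0 \<and> b m = real n \<and> (\<forall>i<m. b i < b (Suc i) \<and> (\<exists>s::int. \<forall>t\<in>{b i..b (Suc i)}.
      trop_ratio n x (at_pos n t) = trop_ratio n x (at_pos n (b i)) + of_int s * (t - b i)))"
    using b(1,2) by blast
  moreover have "trop_ratio n x \<in> extensional (points (interval_graph n))" by (simp add: trop_ratio_def)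
  ultimately show ?thesis by (simp add: PL_def)
qed

lemma outgoing_slope_trop_ratio:
  assumes "0 \<le> t" "t \<le> real n"
  shows "t < real n \<Longrightarrow> outgoing_slope (interval_graph n) (trop_ratio n x) (0, t, 1) =
      int n * (int (Max (minimizers n (\<lambda>_. 0) t)) - int (Max (minimizers n x t)))"
    and "0 < t \<Longrightarrow> outgoing_slope (interval_graph n) (trop_ratio n x) (0, t, - 1) =
      int n * (int (Min (minimizers n x t)) - int (Min (minimizers n (\<lambda>_. 0) t)))"
proof -
  assume t: "t < real n"
  obtain \<epsilon> where e: "\<epsilon> > 0" "\<forall>h\<in>{0..\<epsilon>}. trop n x (t + h) - trop n (\<lambda>_. 0) (t + h) = trop n x t - trop n (\<lambda>_. 0) t +
     of_int (int n * (int (Max (minimizers n (\<lambda>_. 0) t)) - int (Max (minimizers n x t)))) * h"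
    using germ_right by blast
  have "has_outgoing_slope (interval_graph n) (trop_ratio n x) (0, t, 1)
      (int n * (int (Max (minimizers n (\<lambda>_. 0) t)) - int (Max (minimizers n x t))))"
    unfolding has_outgoing_slope.simps
    \<comment> \<open>The germ is shortened so that it stays on the edge.\<close>
    by (rule exI[of _ "min \<epsilon> (real n - t)"]) (use e t assms in \<open>simp add: trop_ratio_at_pos\<close>)
  then show "outgoing_slope (interval_graph n) (trop_ratio n x) (0, t, 1) =
      int n * (int (Max (minimizers n (\<lambda>_. 0) t)) - int (Max (minimizers n x t)))"
    unfolding outgoing_slope_def by (blast intro: outgoing_slope_unique)
next
  assume t: "0 < t"
  obtain \<epsilon> where e: "\<epsilon> > 0" "\<forall>h\<in>{0..\<epsilon>}. trop n x (t - h) - trop n (\<lambda>_. 0) (t - h) = trop n x t - trop n (\<lambda>_. 0) t +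
     of_int (int n * (int (Min (minimizers n x t)) - int (Min (minimizers n (\<lambda>_. 0) t)))) * h"
    using germ_left by blast
  have "has_outgoing_slope (interval_graph n) (trop_ratio n x) (0, t, - 1)
      (int n * (int (Min (minimizers n x t)) - int (Min (minimizers n (\<lambda>_. 0) t))))"
    unfolding has_outgoing_slope.simps
    by (rule exI[of _ "min \<epsilon> t"]) (use e t assms in \<open>simp add: trop_ratio_at_pos\<close>)
  then show "outgoing_slope (interval_graph n) (trop_ratio n x) (0, t, - 1) =
      int n * (int (Min (minimizers n x t)) - int (Min (minimizers n (\<lambda>_. 0) t)))"
    unfolding outgoing_slope_def by (blast intro: outgoing_slope_unique)
qed

text \<open>The slopes of the zero polynomial cancel against \<open>base_divisor\<close>. At an end
  of the interval the missing direction is replaced by the exponent fixed in \<open>lo\<close> or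
  \<open>hi\<close>, which is the same for all polynomials.\<close>

lemma base_divisor_add_div:
  "base_divisor n p + div_of (interval_graph n) (trop_ratio n x) p =
     (if p \<in> points (interval_graph n) then chips n x (pos n p) else 0)"
proof (cases "p \<in> points (interval_graph n)")
  case True
  then obtain t where t: "0 \<le> t" "t \<le> real n" "p = at_pos n t" "pos n p = t" by (rule points_cases)
  have "div_of (interval_graph n) (trop_ratio n x) p = (\<Sum>\<zeta>\<in>tangents (interval_graph n) (at_pos n t). - outgoing_slope (interval_graph n) (trop_ratio n x) \<zeta>)"
    using True t by (simp add: div_of_def)
  then have *: "base_divisor n p + div_of (interval_graph n) (trop_ratio n x) p = chips n (\<lambda>_. 0) t +
      (\<Sum>\<zeta>\<in>(if t < real n then {(0, t, 1)} else {}) \<union> (if 0 < t then {(0, t, - 1)} else {}).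
         - outgoing_slope (interval_graph n) (trop_ratio n x) \<zeta>)"
    using True t by (simp add: base_divisor_def tangents_interval)
  consider "t = 0" | "t = real n" "0 < t" | "0 < t" "t < real n" using t n by fastforce
  then have "base_divisor n p + div_of (interval_graph n) (trop_ratio n x) p = chips n x t"
  proof cases
    case 1
    then show ?thesis
      using n outgoing_slope_trop_ratio(1)[OF t(1,2), of x] unfolding * by (simp add: chips_def hi_def lo_def algebra_simps)
  next
    case 2
    then show ?thesis
      using outgoing_slope_trop_ratio(2)[OF t(1,2), of x] unfolding * by (simp add: chips_def hi_def lo_def algebra_simps)
  next
    case 3
    then show ?thesis
      using outgoing_slope_trop_ratio[OF t(1,2), of x] unfolding * by (simp add: chips_def hi_def lo_def algebra_simps)
  qed
  then show ?thesis using True t by simp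
qed (simp add: base_divisor_def div_of_def)

lemma trop_ratio_RD: "trop_ratio n x \<in> RD (interval_graph n) (base_divisor n)"
  using trop_ratio_PL chips_nonneg[OF n] by (simp add: RD_def effective_def base_divisor_add_div)

end

section \<open>Images of matroids under injections\<close>

text \<open>Used twice: to number the ground set by \<open>{..<n}\<close>, and to pass from numbers
  to components.\<close>

definition image_matroid :: "('a \<Rightarrow> 'b) \<Rightarrow> 'a matroid_data \<Rightarrow> 'b matroid_data" where
  "image_matroid f M = \<lparr>ground = f ` ground M, indep = (\<lambda>Y. \<exists>X. indep M X \<and> Y = f ` X)\<rparr>"

lemma indep_image_matroid:
  assumes m: "matroid M" and f: "inj_on f (ground M)" and X: "X \<subseteq> ground M"
  shows "indep (image_matroid f M) (f ` X) \<longleftrightarrow> indep M X"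
proof
  assume "indep (image_matroid f M) (f ` X)"
  then obtain Z where Z: "indep M Z" "f ` X = f ` Z" by (auto simp: image_matroid_def)
  then have "X = Z" using inj_on_image_eq_iff[OF f X indep_ground[OF m Z(1)]] by simp
  then show "indep M X" using Z by simp
qed (auto simp: image_matroid_def)

lemma matroid_image_matroid:
  assumes m: "matroid M" and f: "inj_on f (ground M)"
  shows "matroid (image_matroid f M)"
  unfolding matroid_def
proof (intro conjI allI impI)
  show "finite (ground (image_matroid f M))" using finite_ground[OF m] by (simp add: image_matroid_def)
  show "indep (image_matroid f M) {}" using indep_empty[OF m] by (simp add: image_matroid_def)
  show "X \<subseteq> ground (image_matroid f M)" if "indep (image_matroid f M) X" for X
    using that indep_ground[OF m] by (fastforce simp: image_matroid_def)
  show "indep (image_matroid f M) X" if Y: "indep (image_matroid f M) Y" "X \<subseteq> Y" for X Y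
  proof -
    obtain Z where Z: "indep M Z" "Y = f ` Z" using Y(1) by (auto simp: image_matroid_def)
    obtain W where "W \<subseteq> Z" "X = f ` W" using Y(2) Z(2) by (auto simp: subset_image_iff)
    then show ?thesis using indep_subset[OF m Z(1)] by (auto simp: image_matroid_def)
  qed
  fix X Y assume "indep (image_matroid f M) X" "indep (image_matroid f M) Y" and c: "card X < card Y"
  then obtain X' Y' where X: "indep M X'" "X = f ` X'" and Y: "indep M Y'" "Y = f ` Y'"
    by (auto simp: image_matroid_def)
  have inj: "inj_on f X'" "inj_on f Y'" using f indep_ground[OF m] X Y inj_on_subset by metis+
  then obtain y where y: "y \<in> Y'" "y \<notin> X'" "indep M (insert y X')"
    using indep_augment[OF m X(1) Y(1)] c X Y by (metis card_image)
  have "f y \<notin> X" using y X indep_ground[OF m y(3)] inj_onD[OF f] by auto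
  moreover have "indep (image_matroid f M) (insert (f y) X)"
    unfolding image_matroid_def using y(3) X(2) by (auto intro!: exI[of _ "insert y X'"])
  ultimately show "\<exists>y\<in>Y - X. indep (image_matroid f M) (insert y X)" using y Y by blast
qed

lemma mrank_image_matroid:
  assumes m: "matroid M" and f: "inj_on f (ground M)" and X: "X \<subseteq> ground M"
  shows "mrank (image_matroid f M) (f ` X) = mrank M X"
proof -
  have Z: "card (f ` Z) = card Z \<and> (indep (image_matroid f M) (f ` Z) \<longleftrightarrow> indep M Z)" if "Z \<subseteq> X" for Z
  proof
    have "Z \<subseteq> ground M" using that X by simp
    then show "card (f ` Z) = card Z" using f by (meson card_image inj_on_subset)
    show "indep (image_matroid f M) (f ` Z) \<longleftrightarrow> indep M Z"
      by (rule indep_image_matroid[OF m f \<open>Z \<subseteq> ground M\<close>])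
  qed
  have "{card Y | Y. Y \<subseteq> f ` X \<and> indep (image_matroid f M) Y} = {card Y | Y. Y \<subseteq> X \<and> indep M Y}"
  proof (intro equalityI subsetI)
    fix c assume "c \<in> {card Y | Y. Y \<subseteq> f ` X \<and> indep (image_matroid f M) Y}"
    then obtain Y where Y: "c = card Y" "Y \<subseteq> f ` X" "indep (image_matroid f M) Y" by auto
    then obtain Z' where "Z' \<subseteq> X" "Y = f ` Z'" by (auto elim: subset_imageE)
    then show "c \<in> {card Y | Y. Y \<subseteq> X \<and> indep M Y}" using Z[of Z'] Y by auto
  next
    fix c assume "c \<in> {card Y | Y. Y \<subseteq> X \<and> indep M Y}"
    then obtain Y where "c = card Y" "Y \<subseteq> X" "indep M Y" by auto
    then show "c \<in> {card Y | Y. Y \<subseteq> f ` X \<and> indep (image_matroid f M) Y}"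
      using Z[of Y] by (intro CollectI exI[of _ "f ` Y"]) auto
  qed
  then show ?thesis by (simp add: mrank_def)
qed

lemma flat_image_matroid:
  assumes m: "matroid M" and f: "inj_on f (ground M)" and F: "F \<subseteq> ground M"
  shows "flat (image_matroid f M) (f ` F) \<longleftrightarrow> flat M F"
proof -
  have g: "ground (image_matroid f M) = f ` ground M" by (simp add: image_matroid_def)
  have d: "f ` ground M - f ` F = f ` (ground M - F)"
    using inj_on_image_set_diff[OF f _ F, of "ground M"] by auto
  have "mrank (image_matroid f M) (insert (f x) (f ` F)) = mrank M (insert x F)" if "x \<in> ground M" for x
    using mrank_image_matroid[OF m f, of "insert x F"] that F by simp
  then show ?thesis
    using F mrank_image_matroid[OF m f F] by (auto simp: flat_def g d image_mono)
qed

lemma matroid_iso_image_matroid: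
  assumes "matroid M" "inj_on f (ground M)"
  shows "matroid_iso M (image_matroid f M)"
  unfolding matroid_iso_def
  by (rule exI[of _ f]) (use indep_image_matroid[OF assms] assms(2) in \<open>auto simp: bij_betw_def image_matroid_def\<close>)

lemma loopless_image_matroid:
  assumes m: "matroid M" and f: "inj_on f (ground M)" and l: "loopless M"
  shows "loopless (image_matroid f M)"
  using l by (fastforce simp: loopless_def image_matroid_def)

lemma matroid_iso_sym:
  assumes "matroid_iso M N"
  shows "matroid_iso N M"
proof -
  obtain f where f: "bij_betw f (ground M) (ground N)"
    "\<And>X. X \<subseteq> ground M \<Longrightarrow> indep M X \<longleftrightarrow> indep N (f ` X)" using assms by (auto simp: matroid_iso_def)
  let ?g = "inv_into (ground M) f"
  have "indep N Y \<longleftrightarrow> indep M (?g ` Y)" if "Y \<subseteq> ground N" for Y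
  proof -
    have "?g ` Y \<subseteq> ground M" using that bij_betw_imp_surj_on[OF bij_betw_inv_into[OF f(1)]] by blast
    moreover have "f ` ?g ` Y = Y" using that f(1) by (metis bij_betw_def image_inv_into_cancel)
    ultimately show ?thesis using f(2) by metis
  qed
  then show ?thesis using bij_betw_inv_into[OF f(1)] by (auto simp: matroid_iso_def)
qed

lemma matroid_iso_trans:
  assumes "matroid_iso L M" "matroid_iso M N"
  shows "matroid_iso L N"
proof -
  obtain f where f: "bij_betw f (ground L) (ground M)"
    "\<And>X. X \<subseteq> ground L \<Longrightarrow> indep L X \<longleftrightarrow> indep M (f ` X)" using assms(1) by (auto simp: matroid_iso_def)
  obtain g where g: "bij_betw g (ground M) (ground N)"
    "\<And>X. X \<subseteq> ground M \<Longrightarrow> indep M X \<longleftrightarrow> indep N (g ` X)" using assms(2) by (auto simp: matroid_iso_def)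
  have "indep L X \<longleftrightarrow> indep N ((g \<circ> f) ` X)" if "X \<subseteq> ground L" for X
  proof -
    have "f ` X \<subseteq> ground M" using that f(1) by (auto simp: bij_betw_def)
    then show ?thesis using f(2)[OF that] g(2) by (simp add: image_comp)
  qed
  then show ?thesis using bij_betw_trans[OF f(1) g(1)] by (auto simp: matroid_iso_def)
qed

section \<open>The tropical linear series of a matroid\<close>

text \<open>An interchange of two minima. Together with \<open>trop_add\<close> it lets the series
  inherit its module structure from \<open>bergman\<close>.\<close>

lemma trop_Min:
  assumes "0 < n" and H: "finite H" "H \<noteq> {}"
  shows "trop n (\<lambda>i. Min ((\<lambda>h. x h i) ` H)) t = Min ((\<lambda>h. trop n (x h) t) ` H)"
proof (rule antisym)
  show "trop n (\<lambda>i. Min ((\<lambda>h. x h i) ` H)) t \<le> Min ((\<lambda>h. trop n (x h) t) ` H)"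
  proof (subst Min_ge_iff; (intro ballI)?)
    fix y assume "y \<in> (\<lambda>h. trop n (x h) t) ` H"
    then obtain h where h: "h \<in> H" "y = trop n (x h) t" by auto
    have "Min ((\<lambda>h. x h i) ` H) \<le> x h i" for i using H h by simp
    then have "trop n (\<lambda>i. Min ((\<lambda>h. x h i) ` H)) t \<le> x h i + line n i t" if "i < n" for i
      using trop_le[OF that, of "\<lambda>i. Min ((\<lambda>h. x h i) ` H)" t] by (meson add_right_mono order_trans)
    then show "trop n (\<lambda>i. Min ((\<lambda>h. x h i) ` H)) t \<le> y" unfolding h using assms(1) by (intro trop_ge)
  qed (use H in auto)
  show "Min ((\<lambda>h. trop n (x h) t) ` H) \<le> trop n (\<lambda>i. Min ((\<lambda>h. x h i) ` H)) t"
  proof (rule trop_ge[OF assms(1)])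
    fix i assume i: "i < n"
    have "Min ((\<lambda>h. x h i) ` H) \<in> (\<lambda>h. x h i) ` H" using H by (intro Min_in) auto
    then obtain h where h: "h \<in> H" "Min ((\<lambda>h. x h i) ` H) = x h i" by auto
    have "Min ((\<lambda>h. trop n (x h) t) ` H) \<le> trop n (x h) t" using H h by simp
    also have "\<dots> \<le> x h i + line n i t" using trop_le[OF i] .
    finally show "Min ((\<lambda>h. trop n (x h) t) ` H) \<le> Min ((\<lambda>h. x h i) ` H) + line n i t" using h by simp
  qed
qed

lemma trop_cong: "(\<And>i. i < n \<Longrightarrow> x i = y i) \<Longrightarrow> trop n x t = trop n y t"
  unfolding trop_def by (intro arg_cong[of _ _ Min] image_cong) auto

lemma trop_min:
  assumes n: "0 < n"
  shows "trop n (\<lambda>i. min (x i) (y i)) t = min (trop n x t) (trop n y t)"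
  using trop_Min[OF n, of "{True, False}" "\<lambda>h. if h then x else y" t] by (simp add: if_distrib if_distribR min.commute)

lemma trop_add:
  assumes n: "0 < n"
  shows "trop n (\<lambda>i. x i + a) t = trop n x t + a"
proof (rule antisym)
  have "trop n (\<lambda>i. x i + a) t - a \<le> trop n x t"
    using n trop_le[of _ n "\<lambda>i. x i + a" t] by (intro trop_ge) (auto simp: algebra_simps)
  then show "trop n (\<lambda>i. x i + a) t \<le> trop n x t + a" by simp
  show "trop n x t + a \<le> trop n (\<lambda>i. x i + a) t"
    using n trop_le[of _ n x t] by (intro trop_ge) (auto simp: algebra_simps)
qed

text \<open>A crude bound; twice its right-hand side is the height at which the generators are cut
  off.\<close>

lemma abs_line_le:
  assumes "i < n" "0 \<le> t" "t \<le> real n"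
  shows "\<bar>line n i t\<bar> \<le> real n * (real n * real n)"
proof -
  have "real i + 1 \<le> real n" using assms(1) by linarith
  then have "\<bar>(real i + 1) / 2 - t\<bar> \<le> real n" using assms(2,3) by (simp add: abs_le_iff field_simps)
  then have "real i * \<bar>(real i + 1) / 2 - t\<bar> \<le> real n * real n" using assms by (intro mult_mono) auto
  moreover have "line n i t = real n * (real i * ((real i + 1) / 2 - t))" by (simp add: line_def algebra_simps)
  ultimately show ?thesis by (simp add: abs_mult mult_left_mono)
qed

definition series :: "nat \<Rightarrow> nat matroid_data \<Rightarrow> ((nat, nat) point \<Rightarrow> real) set" where
  "series n M = trop_ratio n ` bergman M"

definition cell :: "nat \<Rightarrow> nat \<Rightarrow> (nat, nat) point set" where
  "cell n i = edge_pt (interval_graph n) 0 ` (region n i \<inter> {0..real n})"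

section \<open>The base divisor, its complement and the minima of the quotients\<close>

context
  fixes n :: nat
  assumes n: "0 < n"
begin

lemmas pts = points_cases[OF n]
lemmas ratio_at = trop_ratio_at_pos[OF n]

lemma supp_base_divisor: "supp (base_divisor n) = at_pos n ` real ` {1..n - 1}"
proof (intro equalityI subsetI)
  fix p assume p: "p \<in> supp (base_divisor n)"
  then have "p \<in> points (interval_graph n)" by (auto simp: supp_def base_divisor_def split: if_splits)
  then obtain t where t: "0 \<le> t" "t \<le> real n" "p = at_pos n t" "pos n p = t" by (rule pts)
  have c: "chips n (\<lambda>_. 0) t \<noteq> 0" using p t by (auto simp: supp_def base_divisor_def split: if_splits)
  show "p \<in> at_pos n ` real ` {1..n - 1}"
  proof (rule region_cases[OF n t(1,2)])
    fix i assume "i < n" "t \<in> region n i"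
    then show ?thesis using chips_zero_region c t by blast
  next
    fix k assume "0 < k" "k < n" "t = real k"
    then show ?thesis using t by auto
  qed
next
  fix p assume "p \<in> at_pos n ` real ` {1..n - 1}"
  then obtain k where "k \<in> {1..n - 1}" and p: "p = at_pos n (real k)" by blast
  then have k: "0 < k" "k < n" by auto
  then show "p \<in> supp (base_divisor n)"
    unfolding p using at_pos_points[OF n] n by (simp add: supp_def base_divisor_def pos_at_pos[OF n] chips_zero_break)
qed

lemma card_supp_base_divisor: "card (supp (base_divisor n)) = n - 1"
proof -
  have "inj_on (at_pos n) (real ` {1..n - 1})" using inj_on_at_pos[OF n] by (rule inj_on_subset) auto
  then show ?thesis by (simp add: supp_base_divisor card_image)
qed

lemma base_divisor: "is_divisor (interval_graph n) (base_divisor n)" "effective (base_divisor n)"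
  using at_pos_points[OF n] chips_nonneg[OF n]
  by (auto simp: is_divisor_def supp_base_divisor effective_def base_divisor_def)

text \<open>Both extrema are global: a member of the linear system has at most \<open>n - 1\<close>
  points in its support, as many as \<open>D\<close>; and it is effective, while \<open>D\<close>
  has no chip at an end of the interval.\<close>

lemma nondegenerate_series:
  assumes l: "loopless M"
  shows "nondegenerate (interval_graph n) (base_divisor n) (series n M)"
proof -
  let ?G = "interval_graph n" and ?D = "base_divisor n"
  have ls: "linear_system ?G ?D (series n M) =
      (\<lambda>x p. if p \<in> points ?G then chips n x (pos n p) else 0) ` bergman M"
    by (auto simp: linear_system_def series_def image_image base_divisor_add_div[OF n])
  have D: "?D \<in> linear_system ?G ?D (series n M)"
    unfolding ls by (rule image_eqI[of _ _ "\<lambda>_. 0"]) (auto simp: base_divisor_def bergman_const[OF l])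
  have top: "?D \<in> topspace (linear_system_top ?G ?D (series n M))"
    using divisor_in_Sym[OF metric_graph_interval[OF n] base_divisor] D by (simp add: linear_system_top_def)
  have sub: "topspace (linear_system_top ?G ?D (series n M)) \<subseteq> linear_system ?G ?D (series n M)"
    by (simp add: linear_system_top_def)
  have c: "card (supp D') \<le> card (supp ?D)" if D': "D' \<in> linear_system ?G ?D (series n M)" for D'
  proof -
    obtain x where x: "D' = (\<lambda>p. if p \<in> points ?G then chips n x (pos n p) else 0)" using D' unfolding ls by (rule imageE)
    have "supp D' \<subseteq> at_pos n ` {t \<in> {0..real n}. chips n x t \<noteq> 0}"
      by (auto simp: supp_def x elim!: pts)
    then have "card (supp D') \<le> card {t \<in> {0..real n}. chips n x t \<noteq> 0}"
      using card_chips_le[OF n, of x] by (meson card_image_le card_mono finite_imageI order_trans)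
    then show ?thesis using card_chips_le[OF n, of x] card_supp_base_divisor by simp
  qed
  have v: "valence_one_degree ?G ?D \<le> valence_one_degree ?G D'" if D': "D' \<in> linear_system ?G ?D (series n M)" for D'
  proof -
    obtain x where x: "D' = (\<lambda>p. if p \<in> points ?G then chips n x (pos n p) else 0)" using D' unfolding ls by (rule imageE)
    have "?D p = 0" if "p \<in> points ?G" "valence ?G p = 1" for p
    proof (rule ccontr)
      assume "?D p \<noteq> 0"
      then have "p \<in> supp ?D" by (simp add: supp_def)
      then have "p \<in> at_pos n ` real ` {1..n - 1}" unfolding supp_base_divisor .
      then obtain k where "k \<in> {1..n - 1}" and p: "p = at_pos n (real k)" by blast
      then have k: "0 < k" "k < n" by auto
      then have "tangents ?G p = {(0, real k, 1), (0, real k, - 1)}"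
        using tangents_interval[OF n, of "real k"] p by auto
      then show False using that by (simp add: valence_def)
    qed
    then have "valence_one_degree ?G ?D = 0" by (simp add: valence_one_degree_def)
    moreover have "valence_one_degree ?G D' \<ge> 0"
      unfolding valence_one_degree_def by (intro sum_nonneg) (simp add: x chips_nonneg[OF n])
    ultimately show ?thesis by simp
  qed
  show ?thesis
    \<comment> \<open>The neighbourhood is the whole space.\<close>
    unfolding nondegenerate_def local_max_at_def local_min_at_def
    using D top sub c v by (meson openin_topspace subsetD)
qed

text \<open>The cells are open and connected, as homeomorphic images of relatively open intervals,
  and they partition the complement.\<close>

lemma complement_components_interval:
  "complement_components (interval_graph n) (base_divisor n) = cell n ` {..<n}"
proof -
  let ?G = "interval_graph n"
  have un: "(\<Union>i\<in>{..<n}. cell n i) = points ?G - supp (base_divisor n)"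
  proof (intro equalityI subsetI)
    fix p assume "p \<in> (\<Union>i\<in>{..<n}. cell n i)"
    then obtain i t where t: "i < n" "t \<in> region n i" "0 \<le> t" "t \<le> real n" "p = at_pos n t" by (auto simp: cell_def)
    then have "base_divisor n p = 0"
      using at_pos_points[OF n] chips_zero_region[OF t(1-4)] by (simp add: base_divisor_def pos_at_pos[OF n])
    then show "p \<in> points ?G - supp (base_divisor n)" using at_pos_points[OF n] t by (simp add: supp_def)
  next
    fix p assume p: "p \<in> points ?G - supp (base_divisor n)"
    then obtain t where t: "0 \<le> t" "t \<le> real n" "p = at_pos n t" "pos n p = t" using pts by (metis DiffD1)
    show "p \<in> (\<Union>i\<in>{..<n}. cell n i)"
    proof (rule region_cases[OF n t(1,2)])
      fix i assume "i < n" "t \<in> region n i"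
      then show ?thesis using t by (intro UN_I[of i]) (auto simp: cell_def)
    next
      fix k assume "0 < k" "k < n" "t = real k"
      then show ?thesis using p t by (auto simp: supp_base_divisor)
    qed
  qed
  have conv: "connected (region n i \<inter> {0..real n})" for i
    by (rule is_interval_connected) (auto simp: is_interval_1 region_def)
  have opn: "open (region n i)" for i
    unfolding region_def by (intro open_Collect_conj open_Collect_disj open_Collect_const open_Collect_less continuous_intros)
  have op: "openin (gtop ?G) (cell n i)" for i
    unfolding cell_def
    using homeomorphic_map_openness_eq[OF homeomorphic_interval[OF n], of "region n i \<inter> {0..real n}"] opn[of i]
    by (metis Int_commute inf_le2 openin_open topspace_euclidean_subtopology)
  have con: "connectedin (gtop ?G) (cell n i)" for i
    unfolding cell_def
    by (rule connectedin_continuous_map_image[OF homeomorphic_imp_continuous_map[OF homeomorphic_interval[OF n]]])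
      (simp add: connectedin_subtopology conv)
  have "connected_components_of (subtopology (gtop ?G) (points ?G - supp (base_divisor n))) = cell n ` {..<n}"
  proof (rule connected_components_of_open_partition)
    fix i assume i: "i \<in> {..<n}"
    have sub: "cell n i \<subseteq> points ?G - supp (base_divisor n)" using i un by blast
    show "openin (subtopology (gtop ?G) (points ?G - supp (base_divisor n))) (cell n i)"
      using op sub by (meson openin_subset_topspace_eq openin_subtopology_Int2 openin_subtopology subset_openin_subtopology)
    show "connectedin (subtopology (gtop ?G) (points ?G - supp (base_divisor n))) (cell n i)"
      using con sub by (simp add: connectedin_subtopology)
    show "cell n i \<noteq> {}" using mid_region[of i n] i by (auto simp: cell_def)
  next
    show "disjoint_family_on (cell n) {..<n}"
      using region_disjoint inj_onD[OF inj_on_at_pos[OF n]] by (fastforce simp: disjoint_family_on_def cell_def)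
    show "(\<Union>i\<in>{..<n}. cell n i) = topspace (subtopology (gtop ?G) (points ?G - supp (base_divisor n)))"
      using un by (auto simp: topspace_gtop[OF metric_graph_interval[OF n]])
  qed
  then show ?thesis by (simp add: complement_components_def)
qed

lemma inj_on_cell: "inj_on (cell n) {..<n}"
proof (rule inj_onI)
  fix i j assume ij: "i \<in> {..<n}" "j \<in> {..<n}" "cell n i = cell n j"
  have "at_pos n (real i + 1 / 2) \<in> cell n i" using ij(1) mid_region[of i n] by (auto simp: cell_def)
  then obtain t where "t \<in> region n j \<inter> {0..real n}" "at_pos n (real i + 1 / 2) = at_pos n t"
    using ij(3) by (auto simp: cell_def)
  then have "real i + 1 / 2 \<in> region n j" using inj_onD[OF inj_on_at_pos[OF n], of "real i + 1 / 2" t] ij(1) by auto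
  then show "i = j" using region_disjoint mid_region ij by blast
qed

lemma trop_ratio_mid:
  assumes "i < n"
  shows "trop_ratio n x (at_pos n (real i + 1 / 2)) = trop n x (real i + 1 / 2) - line n i (real i + 1 / 2)"
  using assms by (simp add: ratio_at trop_zero_region[OF assms mid_region])

text \<open>With \<open>c\<close> the least coefficient, the quotient is at least \<open>c\<close>
  everywhere and equals \<open>c\<close> on the cell of any coefficient equal to \<open>c\<close>.
  The converse is tested at the midpoint of the cell.\<close>

lemma cell_min_set:
  assumes i: "i < n"
  shows "cell n i \<subseteq> min_set (interval_graph n) (trop_ratio n x) \<longleftrightarrow> x i = Min (x ` {..<n})"
proof -
  define c where "c = Min (x ` {..<n})"
  have c: "c \<le> x j" if "j < n" for j unfolding c_def using that by simp
  have "c \<in> x ` {..<n}" unfolding c_def using n by (intro Min_in) auto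
  then obtain j where j: "j < n" "x j = c" by auto
  have ge: "c + trop n (\<lambda>_. 0) t \<le> trop n x t" for t
    using n c trop_le[of _ n "\<lambda>_. 0" t] by (intro trop_ge) (auto intro: add_mono)
  have le: "trop n x t \<le> c + trop n (\<lambda>_. 0) t" if "k < n" "x k = c" "t \<in> region n k" for k t
    using trop_le[OF that(1), of x t] that trop_zero_region[OF that(1,3)] by simp
  show ?thesis
  proof
    assume "x i = Min (x ` {..<n})"
    then have xi: "x i = c" by (simp add: c_def)
    show "cell n i \<subseteq> min_set (interval_graph n) (trop_ratio n x)"
    proof
      fix p assume "p \<in> cell n i"
      then obtain t where t: "t \<in> region n i" "0 \<le> t" "t \<le> real n" "p = at_pos n t" by (auto simp: cell_def)
      have "trop_ratio n x p \<le> c" using t le[OF i xi t(1)] by (simp add: ratio_at)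
      moreover have "c \<le> trop_ratio n x q" if "q \<in> points (interval_graph n)" for q
        using that ge by (auto elim!: pts simp: ratio_at le_diff_eq)
      ultimately show "p \<in> min_set (interval_graph n) (trop_ratio n x)"
        using t at_pos_points[OF n] by (fastforce simp: min_set_def)
    qed
  next
    assume S: "cell n i \<subseteq> min_set (interval_graph n) (trop_ratio n x)"
    let ?t = "real i + 1 / 2"
    have "at_pos n ?t \<in> cell n i" using i mid_region[of i n] by (auto simp: cell_def)
    then have "trop_ratio n x (at_pos n ?t) \<le> trop_ratio n x (at_pos n (real j + 1 / 2))"
      using S at_pos_points[OF n] by (auto simp: min_set_def)
    moreover have "trop_ratio n x (at_pos n (real j + 1 / 2)) \<le> c"
      using j le[OF j mid_region] by (simp add: ratio_at)
    ultimately have *: "trop n x ?t \<le> c + line n i ?t" by (simp add: trop_ratio_mid[OF i])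
    obtain k where k: "k < n" "x k + line n k ?t = trop n x ?t"
      using minimizers_nonempty[OF n, of x ?t] by (auto simp: minimizers_def)
    \<comment> \<open>At this midpoint the other lines are strictly higher and all coefficients are
      at least \<open>c\<close>, so only the \<open>i\<close>-th term can be this low.\<close>
    have "k = i"
    proof (rule ccontr)
      assume "k \<noteq> i"
      then have "line n i ?t < line n k ?t" using line_less[OF i k(1) _ mid_region] by simp
      then show False using * k c[OF k(1)] by simp
    qed
    then have "x i \<le> c" using * k by simp
    then show "x i = Min (x ` {..<n})" using c[OF i] by (simp add: c_def)
  qed
qed

text \<open>A zero needs a minimal term other than the \<open>i\<close>-th. Its line is strictly
  higher at the midpoint, so its coefficient is smaller.\<close>

lemma chips_mid:
  assumes i: "i < n" and c: "chips n x (real i + 1 / 2) \<noteq> 0"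
  obtains j where "j < n" "x j < x i"
proof -
  let ?t = "real i + 1 / 2"
  \<comment> \<open>The midpoint is inside the interval, away from the end conventions of
    \<open>hi\<close> and \<open>lo\<close>.\<close>
  have "real i + 1 \<le> real n" using i by linarith
  then have "Max (minimizers n x ?t) \<noteq> Min (minimizers n x ?t)" using c by (auto simp: chips_def hi_def lo_def)
  then obtain j where j: "j \<in> minimizers n x ?t" "j \<noteq> i"
    using Max_in[OF finite_minimizers minimizers_nonempty[OF n], of x ?t] Min_in[OF finite_minimizers minimizers_nonempty[OF n], of x ?t]
    by metis
  then have "j < n" "x j + line n j ?t \<le> x i + line n i ?t" using trop_le[OF i, of x ?t] by (auto simp: minimizers_def)
  moreover have "line n i ?t < line n j ?t" using line_less[OF i _ j(2) mid_region] \<open>j < n\<close> by simp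
  ultimately show thesis using that[of j] by simp
qed

end

section \<open>Generation, ranks and local matroid of the series\<close>

context
  fixes n :: nat and M :: "nat matroid_data"
  assumes n: "0 < n" and m: "matroid M" and l: "loopless M" and gr: "ground M = {..<n}"
begin

lemma trop_ratio_Min:
  assumes H: "finite H" "H \<noteq> {}"
  shows "trop_ratio n (\<lambda>i. Min ((\<lambda>h. x h i + a h) ` H)) =
    (\<lambda>p\<in>points (interval_graph n). Min ((\<lambda>h. trop_ratio n (x h) p + a h) ` H))"
proof
  fix p
  have "Min ((\<lambda>h. trop n (x h) t + a h) ` H) - c = Min ((\<lambda>h. trop n (x h) t - c + a h) ` H)" for t c
  proof -
    have "(\<lambda>h. trop n (x h) t - c + a h) ` H = (\<lambda>y. y - c) ` (\<lambda>h. trop n (x h) t + a h) ` H"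
      by (auto simp: image_image algebra_simps)
    then show ?thesis
      using mono_Min_commute[of "\<lambda>y. y - c" "(\<lambda>h. trop n (x h) t + a h) ` H"] H by (simp add: mono_def)
  qed
  then show "trop_ratio n (\<lambda>i. Min ((\<lambda>h. x h i + a h) ` H)) p =
      (\<lambda>p\<in>points (interval_graph n). Min ((\<lambda>h. trop_ratio n (x h) p + a h) ` H)) p"
    using trop_Min[OF n H, of "\<lambda>h i. x h i + a h"] by (simp add: trop_ratio_def trop_add[OF n])
qed

lemma tropical_submodule_series:
  "tropical_submodule (interval_graph n) (base_divisor n) (series n M)"
  unfolding tropical_submodule_def
proof (intro conjI ballI allI)
  show "series n M \<subseteq> RD (interval_graph n) (base_divisor n)"
    by (auto simp: series_def trop_ratio_RD[OF n])
  fix \<phi> assume "\<phi> \<in> series n M"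
  then obtain x where x: "x \<in> bergman M" "\<phi> = trop_ratio n x" by (auto simp: series_def)
  show "(\<lambda>p\<in>points (interval_graph n). \<phi> p + a) \<in> series n M" for a
  proof -
    have "(\<lambda>p\<in>points (interval_graph n). \<phi> p + a) = trop_ratio n (\<lambda>i. x i + a)"
      by (auto simp: x trop_ratio_def trop_add[OF n])
    then show ?thesis using bergman_add[OF x(1)] by (simp add: series_def)
  qed
  fix \<psi> assume "\<psi> \<in> series n M"
  then obtain y where y: "y \<in> bergman M" "\<psi> = trop_ratio n y" by (auto simp: series_def)
  have "(\<lambda>p\<in>points (interval_graph n). min (\<phi> p) (\<psi> p)) = trop_ratio n (\<lambda>i. min (x i) (y i))"
    by (auto simp: x y trop_ratio_def trop_min[OF n] min_diff_distrib_left)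
  then show "(\<lambda>p\<in>points (interval_graph n). min (\<phi> p) (\<psi> p)) \<in> series n M"
    using bergman_min[OF x(1) y(1)] by (simp add: series_def)
qed

lemma trop_ratio_cong: "(\<And>i. i < n \<Longrightarrow> x i = y i) \<Longrightarrow> trop_ratio n x = trop_ratio n y"
  unfolding trop_ratio_def by (simp add: trop_cong[of n x y])

text \<open>A vector is the minimum of its threshold vectors, each shifted by its threshold, up to
  coefficients too high to matter on the interval.\<close>

lemma finitely_generated_series: "finitely_generated (interval_graph n) (series n M)"
proof -
  \<comment> \<open>\<open>T\<close> bounds the difference of any two lines on the interval.\<close>
  define T where "T = 2 * (real n * (real n * real n))"
  define G where "G = trop_ratio n ` {y \<in> bergman M. \<forall>i. y i = 0 \<or> y i = T}"
  have T: "T \<ge> 0" by (simp add: T_def)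
  have "G \<subseteq> (\<lambda>F. trop_ratio n (\<lambda>i. if i \<in> F then T else 0)) ` Pow {..<n}"
  proof
    fix \<phi> assume "\<phi> \<in> G"
    then obtain y where y: "\<forall>i. y i = 0 \<or> y i = T" "\<phi> = trop_ratio n y" by (auto simp: G_def)
    have "\<phi> = trop_ratio n (\<lambda>i. if i \<in> {i. i < n \<and> y i = T} then T else 0)"
      unfolding y(2) by (rule trop_ratio_cong) (use y(1) in auto)
    then show "\<phi> \<in> (\<lambda>F. trop_ratio n (\<lambda>i. if i \<in> F then T else 0)) ` Pow {..<n}" by blast
  qed
  then have fin: "finite G" by (rule finite_subset) simp
  have sub: "G \<subseteq> series n M" by (auto simp: G_def series_def)
  have "series n M \<subseteq> tropical_span (interval_graph n) G"
  proof
    fix \<phi> assume "\<phi> \<in> series n M"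
    then obtain x where x: "x \<in> bergman M" "\<phi> = trop_ratio n x" by (auto simp: series_def)
    define C where "C = x ` {..<n}"
    define y where "y c i = (if x i > c then T else 0)" for c i
    have C: "finite C" "C \<noteq> {}" using n by (auto simp: C_def)
    have yG: "trop_ratio n (y c) \<in> G" for c
      unfolding G_def y_def using bergman_level[OF l x(1) T] by (intro imageI CollectI) auto
    have "trop n x t = trop n (\<lambda>i. Min ((\<lambda>c. y c i + c) ` C)) t" if t: "0 \<le> t" "t \<le> real n" for t
    proof (rule antisym)
      show "trop n (\<lambda>i. Min ((\<lambda>c. y c i + c) ` C)) t \<le> trop n x t"
      proof (rule trop_ge[OF n])
        fix i assume i: "i < n"
        have "Min ((\<lambda>c. y c i + c) ` C) \<le> y (x i) i + x i" using C i by (intro Min_le) (auto simp: C_def)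
        then have "Min ((\<lambda>c. y c i + c) ` C) \<le> x i" by (simp add: y_def)
        then show "trop n (\<lambda>i. Min ((\<lambda>c. y c i + c) ` C)) t \<le> x i + line n i t"
          using trop_le[OF i, of "\<lambda>i. Min ((\<lambda>c. y c i + c) ` C)" t] by simp
      qed
      show "trop n x t \<le> trop n (\<lambda>i. Min ((\<lambda>c. y c i + c) ` C)) t"
      proof (rule trop_ge[OF n])
        fix i assume i: "i < n"
        have "Min ((\<lambda>c. y c i + c) ` C) \<in> (\<lambda>c. y c i + c) ` C" using C by (intro Min_in) auto
        then obtain j where j: "j < n" "Min ((\<lambda>c. y c i + c) ` C) = y (x j) i + x j" by (auto simp: C_def)
        show "trop n x t \<le> Min ((\<lambda>c. y c i + c) ` C) + line n i t"
        proof (cases "x i > x j")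
          \<comment> \<open>The combination may lower coefficient \<open>i\<close> to
            \<open>T + x j\<close>, but by the choice of \<open>T\<close> the resulting term is not
            below the \<open>j\<close>-th term of \<open>x\<close>.\<close>
          case True
          have "line n j t \<le> T + line n i t"
            using abs_line_le[OF i t] abs_line_le[OF j(1) t] by (simp add: T_def)
          then show ?thesis using trop_le[OF j(1), of x t] True j(2) by (simp add: y_def)
        next
          case False
          then show ?thesis using trop_le[OF i, of x t] j(2) by (simp add: y_def)
        qed
      qed
    qed
    then have "\<phi> = trop_ratio n (\<lambda>i. Min ((\<lambda>c. y c i + c) ` C))"
      unfolding x(2) trop_ratio_def by (intro restrict_ext) (auto elim!: points_cases[OF n])
    also have "\<dots> = (\<lambda>p\<in>points (interval_graph n). Min ((\<lambda>c. trop_ratio n (y c) p + c) ` C))"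
      by (rule trop_ratio_Min[OF C])
    also have "\<dots> \<in> tropical_span (interval_graph n) G"
      by (rule tropical_span_indexed[OF C]) (rule yG)
    finally show "\<phi> \<in> tropical_span (interval_graph n) G" .
  qed
  moreover have "tropical_span (interval_graph n) G \<subseteq> series n M"
  proof
    fix \<phi> assume "\<phi> \<in> tropical_span (interval_graph n) G"
    then obtain H a where H: "finite H" "H \<noteq> {}" "H \<subseteq> G"
      and \<phi>: "\<phi> = (\<lambda>p\<in>points (interval_graph n). Min ((\<lambda>\<psi>. \<psi> p + a \<psi>) ` H))"
      unfolding tropical_span_def by blast
    have "\<forall>\<psi>\<in>H. \<exists>y. y \<in> bergman M \<and> \<psi> = trop_ratio n y" using H(3) sub by (auto simp: series_def)
    then obtain y where y: "\<And>\<psi>. \<psi> \<in> H \<Longrightarrow> y \<psi> \<in> bergman M \<and> \<psi> = trop_ratio n (y \<psi>)" by metis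
    have "\<phi> = (\<lambda>p\<in>points (interval_graph n). Min ((\<lambda>\<psi>. trop_ratio n (y \<psi>) p + a \<psi>) ` H))"
      unfolding \<phi> using y by (intro restrict_ext arg_cong[of _ _ Min] image_cong) auto
    also have "\<dots> = trop_ratio n (\<lambda>i. Min ((\<lambda>\<psi>. y \<psi> i + a \<psi>) ` H))" by (rule trop_ratio_Min[OF H(1,2), symmetric])
    also have "\<dots> \<in> series n M"
      unfolding series_def using y by (intro imageI bergman_Min[OF H(1,2)] bergman_add) auto
    finally show "\<phi> \<in> series n M" .
  qed
  ultimately show ?thesis unfolding finitely_generated_def using fin sub by blast
qed

lemma mrank_pos: "0 < mrank M (ground M)"
proof -
  have "indep M {0}" using l n gr by (simp add: loopless_def)
  then show ?thesis using card_le_mrank[OF m, of "{0}" "ground M"] n gr by simp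
qed

lemma mrank_le: "mrank M (ground M) \<le> n"
proof -
  obtain I where "I \<subseteq> ground M" "indep M I" "card I = mrank M (ground M)" using mrank_attained[OF m] .
  then show ?thesis using card_mono[of "{..<n}" I] gr by simp
qed

abbreviation (input) mid :: "nat \<Rightarrow> (nat, nat) point" where
  "mid i \<equiv> edge_pt (interval_graph n) 0 (real i + 1 / 2)"

lemma inj_on_mid: "inj_on mid {..<n}"
proof (rule inj_onI)
  fix i j assume "i \<in> {..<n}" "j \<in> {..<n}" "mid i = mid j"
  then show "i = j" using inj_onD[OF inj_on_at_pos[OF n], of "real i + 1 / 2" "real j + 1 / 2"] by auto
qed

text \<open>Having a zero at \<open>t\<close> means lying on a tropical hyperplane, so
  \<open>bergman_meets_hyperplanes\<close> gives one bound. For the other, the midpoints belonging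
  to a basis cannot all be zeros.\<close>

lemma BN_rank_series:
  "BN_rank (interval_graph n) (base_divisor n) (series n M) (int (mrank M (ground M)) - 1)"
  unfolding BN_rank_def is_largest_def
proof (intro conjI allI impI)
  let ?G = "interval_graph n" and ?r = "int (mrank M (ground M)) - 1"
  have net: "base_divisor n p - D' p + div_of ?G (trop_ratio n x) p =
      (if p \<in> points ?G then chips n x (pos n p) else 0) - D' p" for x D' p
    using base_divisor_add_div[OF n, of p x] by linarith
  fix D' assume D': "is_divisor ?G D' \<and> effective D' \<and> deg D' = ?r"
  then have fin: "finite (supp D')" and pt: "supp D' \<subseteq> points ?G" and nn: "\<And>p. D' p \<ge> 0"
    by (auto simp: is_divisor_def effective_def)
  \<comment> \<open>Only the number of distinct points matters, which is at most the degree.\<close>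
  have "int (card (supp D')) = (\<Sum>p\<in>supp D'. 1)" by simp
  also have "\<dots> \<le> deg D'" unfolding deg_def
    by (rule sum_mono) (use nn in \<open>auto simp: supp_def int_one_le_iff_zero_less order_less_le\<close>)
  finally have "card (supp D') < mrank M (ground M)" using D' by simp
  then have "card (pos n ` supp D') < mrank M (ground M)" using card_image_le[OF fin] by (rule le_less_trans[rotated])
  then obtain x where x: "x \<in> bergman M"
    "\<And>t. t \<in> pos n ` supp D' \<Longrightarrow> \<exists>i\<in>ground M. \<exists>j\<in>ground M. i \<noteq> j \<and> x i + line n i t = x j + line n j t \<and>
       (\<forall>k\<in>ground M. x i + line n i t \<le> x k + line n k t)"
    using bergman_meets_hyperplanes[OF m l, of "pos n ` supp D'" "\<lambda>t i. line n i t"] fin by blast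
  have "D' p \<le> (if p \<in> points ?G then chips n x (pos n p) else 0)" for p
  proof (cases "p \<in> supp D'")
    case True
    then obtain i j where ij: "i < n" "j < n" "i \<noteq> j" "x i + line n i (pos n p) = x j + line n j (pos n p)"
      "\<And>k. k < n \<Longrightarrow> x i + line n i (pos n p) \<le> x k + line n k (pos n p)"
      using x(2)[of "pos n p"] gr by auto
    then have "x i + line n i (pos n p) = trop n x (pos n p)"
      by (intro antisym trop_ge[OF n] trop_le)
    then have "int n \<le> chips n x (pos n p)"
      using ij by (intro chips_tie[of i _ _ _ j]) (auto simp: minimizers_def)
    \<comment> \<open>The multiplicity demanded is below the rank, hence below \<open>n\<close>,
      which every zero provides.\<close>
    moreover have "D' p \<le> deg D'" unfolding deg_def using True fin nn by (intro member_le_sum) auto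
    ultimately show ?thesis using True pt D' mrank_le by auto
  next
    case False
    then show ?thesis using chips_nonneg[OF n] by (simp add: supp_def)
  qed
  then have "effective (\<lambda>p. base_divisor n p - D' p + div_of ?G (trop_ratio n x) p)"
    unfolding effective_def net by simp
  then show "\<exists>\<phi>\<in>series n M. effective (\<lambda>p. base_divisor n p - D' p + div_of ?G \<phi> p)"
    using x(1) by (auto simp: series_def)
next
  let ?G = "interval_graph n" and ?r = "int (mrank M (ground M)) - 1"
  fix s assume s: "\<forall>D'. is_divisor ?G D' \<and> effective D' \<and> deg D' = s \<longrightarrow>
    (\<exists>\<phi>\<in>series n M. effective (\<lambda>p. base_divisor n p - D' p + div_of ?G \<phi> p))"
  show "s \<le> ?r"
  proof (rule ccontr)
    assume "\<not> s \<le> ?r"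
    then have sr: "?r < s" by simp
    obtain I where I: "I \<subseteq> ground M" "indep M I" "card I = mrank M (ground M)" using mrank_attained[OF m] .
    then have In: "I \<subseteq> {..<n}" and fI: "finite I" and neI: "I \<noteq> {}"
      using gr mrank_pos finite_subset by auto
    obtain i0 where i0: "i0 \<in> I" using neI by blast
    \<comment> \<open>One chip at the midpoint of each element of a basis, with the excess at
      \<open>mid i0\<close> to reach degree \<open>s\<close>.\<close>
    define D' where "D' p = (if p = mid i0 then s - ?r else if p \<in> mid ` I then 1 else 0)" for p
    have inj: "inj_on mid I" using inj_on_mid In by (rule inj_on_subset)
    have supp: "supp D' = mid ` I" using i0 sr by (auto simp: supp_def D'_def)
    have "deg D' = (\<Sum>p\<in>mid ` I. if p = mid i0 then s - ?r else 1)"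
      unfolding deg_def supp by (rule sum.cong) (auto simp: D'_def)
    also have "\<dots> = (s - ?r) + (\<Sum>p\<in>mid ` I - {mid i0}. 1)"
      using i0 fI by (subst sum.remove[of _ "mid i0"]) auto
    also have "\<dots> = s"
      using i0 fI I(3) inj mrank_pos by (simp add: card_image of_nat_diff)
    finally have deg: "deg D' = s" .
    have "is_divisor ?G D'" "effective D'"
      using fI at_pos_points[OF n] sr by (auto simp: is_divisor_def supp effective_def D'_def)
    then obtain \<phi> where "\<phi> \<in> series n M" and e: "effective (\<lambda>p. base_divisor n p - D' p + div_of ?G \<phi> p)"
      using s deg by blast
    then obtain x where x: "x \<in> bergman M" "\<phi> = trop_ratio n x" by (auto simp: series_def)
    \<comment> \<open>A zero at \<open>mid i\<close> requires a smaller coefficient, which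
      \<open>basis_dominates\<close> brings back into \<open>I\<close>. This is impossible for the
      least coefficient on \<open>I\<close>.\<close>
    have less: "\<exists>k\<in>I. x k < x i" if i: "i \<in> I" for i
    proof -
      have "D' (mid i) \<ge> 1" using i sr by (auto simp: D'_def)
      moreover have "pos n (mid i) = real i + 1 / 2" using i In by (intro pos_at_pos[OF n]) force+
      ultimately have "chips n x (real i + 1 / 2) \<noteq> 0"
        using e[unfolded effective_def, rule_format, of "mid i"] base_divisor_add_div[OF n, of "mid i" x]
          at_pos_points[OF n] by (simp add: x(2))
      then obtain j where j: "j < n" "x j < x i" using chips_mid[OF n] i In by blast
      obtain k where "k \<in> I" "x k \<le> x j"
        using basis_dominates[OF m I(2,3) x(1)] j(1) gr by (metis lessThan_iff)
      then show ?thesis using j(2) by (meson le_less_trans)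
    qed
    have "Min (x ` I) \<in> x ` I" using fI neI by (intro Min_in) auto
    then obtain i where i: "i \<in> I" "Min (x ` I) = x i" by auto
    then obtain k where "k \<in> I" "x k < x i" using less by blast
    then show False using i fI by (metis Min_le finite_imageI imageI not_le)
  qed
qed

text \<open>The functions of a basis are independent by their values at midpoints: at most
  \<open>0\<close> on the diagonal, positive off it. Conversely, dependence of the coefficient
  vectors passes to the functions.\<close>

lemma ind_rank_series: "ind_rank (interval_graph n) (series n M) (int (mrank M (ground M)))"
  unfolding ind_rank_def is_largest_def
proof (intro conjI allI impI)
  let ?G = "interval_graph n"
  obtain I where I: "I \<subseteq> ground M" "indep M I" "card I = mrank M (ground M)" using mrank_attained[OF m] .
  then have In: "I \<subseteq> {..<n}" and fI: "finite I" and neI: "I \<noteq> {}"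
    using gr mrank_pos finite_subset by auto
  have "\<forall>k\<in>I. \<exists>x. x \<in> bergman M \<and> x k = 0 \<and> (\<forall>i\<in>I - {k}. x i = 1)"
    using bergman_separating[OF m l I(2), of _ 1] by (metis zero_le_one)
  then obtain x where x: "\<And>k. k \<in> I \<Longrightarrow> x k \<in> bergman M" "\<And>k. k \<in> I \<Longrightarrow> x k k = 0"
    "\<And>k i. k \<in> I \<Longrightarrow> i \<in> I \<Longrightarrow> i \<noteq> k \<Longrightarrow> x k i = 1" by (metis Diff_iff singletonD)
  \<comment> \<open>On the basis the values are \<open>0\<close> and \<open>1\<close>, and the
    minimum is taken there.\<close>
  have nonneg: "x k i \<ge> 0" if k: "k \<in> I" and i: "i < n" for k i
  proof -
    obtain j where "j \<in> I" "x k j \<le> x k i"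
      using basis_dominates[OF m I(2,3) x(1)[OF k]] i gr by (metis lessThan_iff)
    then show ?thesis using x(2)[OF k] x(3)[OF k, of j] by (cases "j = k") auto
  qed
  have own: "trop_ratio n (x k) (mid k) \<le> 0" if "k \<in> I" for k
    using that In trop_le[of k n "x k" "real k + 1 / 2"] x(2)[OF that] by (auto simp: trop_ratio_mid[OF n])
  have other: "trop_ratio n (x k) (mid i) > 0" if ki: "k \<in> I" "i \<in> I" "i \<noteq> k" for k i
  proof -
    have i: "i < n" using ki In by auto
    obtain j where j: "j < n" "x k j + line n j (real i + 1 / 2) = trop n (x k) (real i + 1 / 2)"
      using minimizers_nonempty[OF n, of "x k" "real i + 1 / 2"] by (auto simp: minimizers_def)
    have "line n i (real i + 1 / 2) < x k j + line n j (real i + 1 / 2)"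
    proof (cases "j = i")
      case True
      then show ?thesis using x(3)[OF ki] by simp
    next
      case False
      then show ?thesis using line_less[OF i j(1) _ mid_region] nonneg[OF ki(1) j(1)] by (metis add_strict_increasing2)
    qed
    then show ?thesis using j(2) by (simp add: trop_ratio_mid[OF n i])
  qed
  have inj: "inj_on (\<lambda>k. trop_ratio n (x k)) I"
    by (rule inj_onI) (use own other in \<open>metis not_le\<close>)
  let ?S = "(\<lambda>k. trop_ratio n (x k)) ` I"
  have "\<not> tropically_dependent ?G ?S"
  proof
    assume "tropically_dependent ?G ?S"
    then obtain a where a: "\<And>p. p \<in> points ?G \<Longrightarrow> \<exists>\<phi>\<in>?S. \<exists>\<psi>\<in>?S. \<phi> \<noteq> \<psi> \<and> \<phi> p + a \<phi> = \<psi> p + a \<psi> \<and>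
        (\<forall>\<theta>\<in>?S. \<phi> p + a \<phi> \<le> \<theta> p + a \<theta>)"
      unfolding tropically_dependent_def by blast
    define b where "b k = a (trop_ratio n (x k))" for k
    \<comment> \<open>A tie at \<open>mid i\<close> involves some \<open>j\<close> other than
      \<open>i\<close>, and the signs of the values force \<open>b j < b i\<close>; so no
      \<open>b i\<close> can be least.\<close>
    have less: "\<exists>k\<in>I. b k < b i" if i: "i \<in> I" for i
    proof -
      have "mid i \<in> points ?G" by (rule at_pos_points[OF n])
      from a[OF this] obtain k k' where k: "k \<in> I" "k' \<in> I" "k \<noteq> k'"
        "trop_ratio n (x k) (mid i) + b k = trop_ratio n (x k') (mid i) + b k'"
        "\<And>j. j \<in> I \<Longrightarrow> trop_ratio n (x k) (mid i) + b k \<le> trop_ratio n (x j) (mid i) + b j"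
        unfolding b_def by blast
      then obtain j where j: "j \<in> I" "j \<noteq> i" "trop_ratio n (x j) (mid i) + b j \<le> trop_ratio n (x i) (mid i) + b i"
        using i by (metis order_refl)
      then show ?thesis using own[OF i] other[OF j(1) i] by (intro bexI[of _ j]) auto
    qed
    have "Min (b ` I) \<in> b ` I" using fI neI by (intro Min_in) auto
    then obtain i where i: "i \<in> I" "Min (b ` I) = b i" by auto
    then obtain k where "k \<in> I" "b k < b i" using less by blast
    then show False using i fI by (metis Min_le finite_imageI imageI not_le)
  qed
  moreover have "?S \<subseteq> series n M" using x(1) by (auto simp: series_def)
  moreover have "int (card ?S) = int (mrank M (ground M))" using I(3) inj by (simp add: card_image)
  ultimately show "\<exists>S. S \<subseteq> series n M \<and> finite S \<and> \<not> tropically_dependent ?G S \<and> int (card S) = int (mrank M (ground M))"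
    using fI by (intro exI[of _ ?S]) auto
next
  let ?G = "interval_graph n"
  fix k assume "\<exists>S. S \<subseteq> series n M \<and> finite S \<and> \<not> tropically_dependent ?G S \<and> int (card S) = k"
  then obtain S where S: "S \<subseteq> series n M" "finite S" "\<not> tropically_dependent ?G S" "int (card S) = k" by blast
  show "k \<le> int (mrank M (ground M))"
  proof (rule ccontr)
    assume "\<not> ?thesis"
    then have c: "card S > mrank M (ground M)" using S(4) by simp
    have "\<forall>\<psi>\<in>S. \<exists>y. y \<in> bergman M \<and> \<psi> = trop_ratio n y" using S(1) by (auto simp: series_def)
    then obtain y where y: "\<And>\<psi>. \<psi> \<in> S \<Longrightarrow> y \<psi> \<in> bergman M" "\<And>\<psi>. \<psi> \<in> S \<Longrightarrow> \<psi> = trop_ratio n (y \<psi>)" by metis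
    obtain b where b: "\<forall>i\<in>ground M. \<exists>\<phi>\<in>S. \<exists>\<psi>\<in>S. \<phi> \<noteq> \<psi> \<and> y \<phi> i + b \<phi> = y \<psi> i + b \<psi> \<and>
       (\<forall>\<theta>\<in>S. y \<phi> i + b \<phi> \<le> y \<theta> i + b \<theta>)"
      using bergman_dependent[OF m S(2) c, of y, OF y(1)] .
    have "tropically_dependent ?G S"
      unfolding tropically_dependent_def
    proof (intro exI[of _ b] ballI)
      fix p assume p: "p \<in> points ?G"
      define t where "t = pos n p"
      have val: "\<psi> p = trop n (y \<psi>) t - trop n (\<lambda>_. 0) t" if "\<psi> \<in> S" for \<psi>
      proof -
        have "\<psi> p = trop_ratio n (y \<psi>) p" using fun_cong[OF y(2)[OF that], of p] .
        also have "\<dots> = trop n (y \<psi>) t - trop n (\<lambda>_. 0) t" using p by (simp add: trop_ratio_def t_def)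
        finally show ?thesis .
      qed
      have "S \<noteq> {}" using c by auto
      have "Min ((\<lambda>\<psi>. trop n (y \<psi>) t + b \<psi>) ` S) \<in> (\<lambda>\<psi>. trop n (y \<psi>) t + b \<psi>) ` S"
        using S(2) \<open>S \<noteq> {}\<close> by (intro Min_in) auto
      then obtain \<psi> where \<psi>: "\<psi> \<in> S" "Min ((\<lambda>\<psi>. trop n (y \<psi>) t + b \<psi>) ` S) = trop n (y \<psi>) t + b \<psi>" by auto
      have min: "trop n (y \<psi>) t + b \<psi> \<le> trop n (y \<theta>) t + b \<theta>" if "\<theta> \<in> S" for \<theta>
        using \<psi>(2) Min_le[of "(\<lambda>\<psi>. trop n (y \<psi>) t + b \<psi>) ` S" "trop n (y \<theta>) t + b \<theta>"] that S(2) by auto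
      \<comment> \<open>The function minimal at \<open>p\<close> takes its value from term
        \<open>i\<close>. Functions whose vectors tie for the minimum at coordinate \<open>i\<close>
        have there a term no larger, so they reach the minimum at \<open>p\<close> as well.\<close>
      obtain i where i: "i < n" "y \<psi> i + line n i t = trop n (y \<psi>) t"
        using minimizers_nonempty[OF n, of "y \<psi>" t] by (auto simp: minimizers_def)
      obtain \<phi>1 \<phi>2 where \<phi>: "\<phi>1 \<in> S" "\<phi>2 \<in> S" "\<phi>1 \<noteq> \<phi>2" "y \<phi>1 i + b \<phi>1 = y \<phi>2 i + b \<phi>2"
        "\<forall>\<theta>\<in>S. y \<phi>1 i + b \<phi>1 \<le> y \<theta> i + b \<theta>" using b i(1) gr by blast
      have eq: "trop n (y \<phi>) t + b \<phi> = trop n (y \<psi>) t + b \<psi>" if "\<phi> \<in> S" "y \<phi> i + b \<phi> \<le> y \<psi> i + b \<psi>" for \<phi>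
        using min[OF that(1)] trop_le[OF i(1), of "y \<phi>" t] that(2) i(2) by linarith
      have "trop n (y \<phi>1) t + b \<phi>1 = trop n (y \<psi>) t + b \<psi>" "trop n (y \<phi>2) t + b \<phi>2 = trop n (y \<psi>) t + b \<psi>"
        using eq[OF \<phi>(1)] eq[OF \<phi>(2)] \<phi>(4,5) \<psi>(1) by auto
      then have "\<phi>1 p + b \<phi>1 = \<phi>2 p + b \<phi>2" and "\<forall>\<theta>\<in>S. \<phi>1 p + b \<phi>1 \<le> \<theta> p + b \<theta>"
        using val[OF \<phi>(1)] val[OF \<phi>(2)] min by (simp_all add: val)
      then show "\<exists>\<phi>\<in>S. \<exists>\<psi>\<in>S. \<phi> \<noteq> \<psi> \<and> \<phi> p + b \<phi> = \<psi> p + b \<psi> \<and> (\<forall>\<theta>\<in>S. \<phi> p + b \<phi> \<le> \<theta> p + b \<theta>)"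
        using \<phi>(1-3) by blast
    qed
    then show False using S(3) by simp
  qed
qed

lemma F_of_trop_ratio:
  "F_of (interval_graph n) (base_divisor n) (trop_ratio n x) = cell n ` {i \<in> ground M. x i > Min (x ` {..<n})}"
proof -
  have "x i \<noteq> Min (x ` {..<n}) \<longleftrightarrow> x i > Min (x ` {..<n})" if "i < n" for i
  proof -
    have "Min (x ` {..<n}) \<le> x i" using that by simp
    then show ?thesis by linarith
  qed
  then show ?thesis
    unfolding F_of_def complement_components_interval[OF n] gr
    using cell_min_set[OF n] by (auto intro!: imageI)
qed

text \<open>Proper flats are exactly the sets where some vector exceeds its minimum. The ground set
  is not of this form and is the flat adjoined separately.\<close>

lemma local_matroid_series:
  "is_local_matroid (interval_graph n) (base_divisor n) (series n M) (image_matroid (cell n) M)"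
  unfolding is_local_matroid_def complement_components_interval[OF n]
proof (intro conjI)
  let ?N = "image_matroid (cell n) M"
  have inj: "inj_on (cell n) (ground M)" using inj_on_cell[OF n] gr by simp
  show "matroid ?N" by (rule matroid_image_matroid[OF m inj])
  show gN: "ground ?N = cell n ` {..<n}" by (simp add: image_matroid_def gr)
  show "{F. flat ?N F} = F_of (interval_graph n) (base_divisor n) ` series n M \<union> {cell n ` {..<n}}"
  proof (intro equalityI subsetI)
    fix F assume "F \<in> {F. flat ?N F}"
    then have F: "flat ?N F" "F \<subseteq> cell n ` ground M" using gN gr by (auto simp: flat_def)
    then obtain F' where F': "F' \<subseteq> ground M" "F = cell n ` F'" by (auto elim: subset_imageE)
    then have fl: "flat M F'" using flat_image_matroid[OF m inj] F(1) by simp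
    show "F \<in> F_of (interval_graph n) (base_divisor n) ` series n M \<union> {cell n ` {..<n}}"
    proof (cases "F' = ground M")
      case False
      \<comment> \<open>A proper flat omits some \<open>j\<close>, so its indicator has minimum
        \<open>0\<close> and exceeds it exactly on the flat.\<close>
      let ?x = "\<lambda>i. if i \<in> F' then 1 else (0::real)"
      obtain j where "j < n" "j \<notin> F'" using False F'(1) gr by auto
      then have "Min (?x ` {..<n}) = 0" by (intro Min_eqI) (auto intro!: image_eqI[of _ _ j])
      then have "F_of (interval_graph n) (base_divisor n) (trop_ratio n ?x) = F"
        unfolding F_of_trop_ratio using F' by (auto intro!: arg_cong[of _ _ "(`) (cell n)"])
      then show ?thesis using flat_bergman[OF m l fl] by (auto simp: series_def)
    qed (use F' gr in auto)
  next
    fix F assume "F \<in> F_of (interval_graph n) (base_divisor n) ` series n M \<union> {cell n ` {..<n}}"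
    then consider x where "x \<in> bergman M" "F = cell n ` {i \<in> ground M. x i > Min (x ` {..<n})}" | "F = cell n ` ground M"
      by (auto simp: series_def F_of_trop_ratio gr)
    then show "F \<in> {F. flat ?N F}"
    proof cases
      case 1
      then show ?thesis using flat_image_matroid[OF m inj] bergman_flat[OF m 1(1)] by auto
    next
      case 2
      have "flat M (ground M)" by (simp add: flat_def)
      then show ?thesis using flat_image_matroid[OF m inj] 2 by auto
    qed
  qed
qed

end

theorem theorem1p18:
  fixes M :: "'a matroid_data"
  assumes "matroid M" and "loopless M" and "ground M \<noteq> {}"
  shows "\<exists>(\<Gamma> :: (nat, nat) metric_graph_data) D \<Sigma> r N.
           metric_graph \<Gamma> \<and> is_divisor \<Gamma> D \<and>
           tropical_linear_series \<Gamma> D \<Sigma> r \<and>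
           nondegenerate \<Gamma> D \<Sigma> \<and>
           is_local_matroid \<Gamma> D \<Sigma> N \<and> matroid_iso N M"
proof -
  define n where "n = card (ground M)"
  have n: "0 < n" using assms finite_ground by (auto simp: n_def card_gt_0_iff)
  obtain f where f: "bij_betw f (ground M) {..<n}"
    using ex_bij_betw_finite_nat[OF finite_ground[OF assms(1)]] by (auto simp: n_def atLeast0LessThan)
  then have inj: "inj_on f (ground M)" by (simp add: bij_betw_def)
  \<comment> \<open>\<open>L\<close> is \<open>M\<close> with its elements numbered; the matroid on
    the components is the image of \<open>L\<close> under \<open>cell\<close>.\<close>
  define L where "L = image_matroid f M"
  have m: "matroid L" unfolding L_def by (rule matroid_image_matroid[OF assms(1) inj])
  have l: "loopless L" unfolding L_def by (rule loopless_image_matroid[OF assms(1) inj assms(2)])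
  have gr: "ground L = {..<n}" using f by (simp add: L_def image_matroid_def bij_betw_def)
  have injc: "inj_on (cell n) (ground L)" using inj_on_cell[OF n] gr by simp
  have "tropical_linear_series (interval_graph n) (base_divisor n) (series n L) (int (mrank L (ground L)) - 1)"
    unfolding tropical_linear_series_def
    using tropical_submodule_series[OF n m l gr] finitely_generated_series[OF n m l gr]
      BN_rank_series[OF n m l gr] ind_rank_series[OF n m l gr] by simp
  moreover have "matroid_iso (image_matroid (cell n) L) M"
    using matroid_iso_trans[OF matroid_iso_image_matroid[OF assms(1) inj, folded L_def]
        matroid_iso_image_matroid[OF m injc]] by (rule matroid_iso_sym)
  ultimately show ?thesis
    using metric_graph_interval[OF n] base_divisor(1)[OF n] nondegenerate_series[OF n l]
      local_matroid_series[OF n m l gr] by blast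
qed

end
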